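(* Let $\mathcal{C}\leq RG$ be a relative projective group code with corresponding chain $\mathcal{C}_\star: C_0\leq\dots\leq C_{\ell-1}$. Then $$d_H(\mathcal{C})=d_H(C_{\ell-1}).$$
   Context: $R$ is a commutative Artinian chain ring with $1$, with maximal ideal $\mathfrak{m}=\pi R$ ($\pi$ a fixed generator) and residue field $\mathbb{F}=R/\mathfrak{m}$, a finite field of characteristic $p$. $\ell$ is the length of $R$, i.e. the minimal natural number with $\mathfrak{m}^\ell=\{0\}$. $G$ is a finite group; $RG$ and $\mathbb{F}G$ are the group rings. For $j=0,\dots,\ell-1$ let $\alpha_j:\mathfrak{m}^jRG/\mathfrak{m}^{j+1}RG\to\mathbb{F}G$ be the $R$-module isomorphism given coefficientwise by $\pi^jr+\mathfrak{m}^{j+1}\mapsto r+\mathfrak{m}$. A group code over $R$ (resp. $\mathbb{F}$) is a left ideal in $RG$ (resp. $\mathbb{F}G$). A group code $\mathcal{C}\leq RG$ is called relative projective if it is relative projective for the subgroup $\{1\}$ of $G$, i.e. for any short exact sequence $0\to\mathcal{M}\to\mathcal{N}\xrightarrow{\varphi}\mathcal{C}\to 0$ of (left) $RG$-modules for which there is an $R$-module homomorphism $\psi:\mathcal{C}\to\mathcal{N}$ with $\varphi\circ\psi=\mathrm{id}_{\mathcal{C}}$, there is an $RG$-module homomorphism $\psi':\mathcal{C}\to\mathcal{N}$ with $\varphi\circ\psi'=\mathrm{id}_{\mathcal{C}}$. The chain $\mathcal{C}_\star$ corresponding to $\mathcal{C}$ consists of the codes $$C_j:=\alpha_j\left(\frac{\mathcal{C}\cap\mathfrak{m}^jRG}{\mathcal{C}\cap\mathfrak{m}^{j+1}RG}\right)\leq\mathbb{F}G,\qquad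 0\le j\le\ell-1,$$ where the quotient is regarded as a submodule of $\mathfrak{m}^jRG/\mathfrak{m}^{j+1}RG$. For a group code $C$ over $R$ or over $\mathbb{F}$, the Hamming weight of $c=\sum_{g\in G}c_gg\in C$ is $w_H(c)=|\{g\in G\mid c_g\neq0\}|$, and the Hamming minimum distance is $d_H(C)=\min\{w_H(c)\mid 0\neq c\in C\}$ (the minimum over the empty set, for the zero code, being read as $+\infty$). *)

theory Defs
  imports "HOL-Algebra.QuotRing" "HOL-Algebra.Ideal_Product" "HOL-Algebra.Multiplicative_Group"
    "HOL-Library.Extended_Nat"
begin

section \<open>Artinian chain rings\<close>

locale artinian_chain_ring = cring R for R (structure) +
  assumes ideals_chain: "\<lbrakk>ideal I R; ideal J R\<rbrakk> \<Longrightarrow> I \<subseteq> J \<or> J \<subseteq> I"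
    and descending_chain:
      "\<lbrakk>\<And>n::nat. ideal (A n) R; \<And>n. A (Suc n) \<subseteq> A n\<rbrakk> \<Longrightarrow> \<exists>n. \<forall>k\<ge>n. A k = A n"

abbreviation ideal_power :: "('r, 'a) ring_scheme \<Rightarrow> 'r set \<Rightarrow> nat \<Rightarrow> 'r set" where
  "ideal_power R m j \<equiv> m [^]\<^bsub>ideals_set R\<^esub> j"

definition chain_length :: "('r, 'a) ring_scheme \<Rightarrow> 'r set \<Rightarrow> nat" where
  "chain_length R m = (LEAST n. ideal_power R m n = {\<zero>\<^bsub>R\<^esub>})"

section \<open>Group rings\<close>

definition group_ring :: "('r, 'a) ring_scheme \<Rightarrow> ('g, 'b) monoid_scheme \<Rightarrow> ('g \<Rightarrow> 'r) ring" where
  "group_ring R G =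
    \<lparr>carrier = carrier G \<rightarrow>\<^sub>E carrier R,
     mult = (\<lambda>x y. \<lambda>g\<in>carrier G.
        \<Oplus>\<^bsub>R\<^esub>h\<in>carrier G. x h \<otimes>\<^bsub>R\<^esub> y (inv\<^bsub>G\<^esub> h \<otimes>\<^bsub>G\<^esub> g)),
     one = (\<lambda>g\<in>carrier G. if g = \<one>\<^bsub>G\<^esub> then \<one>\<^bsub>R\<^esub> else \<zero>\<^bsub>R\<^esub>),
     zero = (\<lambda>g\<in>carrier G. \<zero>\<^bsub>R\<^esub>),
     add = (\<lambda>x y. \<lambda>g\<in>carrier G. x g \<oplus>\<^bsub>R\<^esub> y g)\<rparr>"

text \<open>The element \<open>r g\<close> of the group ring.\<close>

definition gr_monom :: "('r, 'a) ring_scheme \<Rightarrow> ('g, 'b) monoid_scheme \<Rightarrow> 'g \<Rightarrow> 'r \<Rightarrow> 'g \<Rightarrow> 'r" where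
  "gr_monom R G g r = (\<lambda>x\<in>carrier G. if x = g then r else \<zero>\<^bsub>R\<^esub>)"

abbreviation gr_scalar :: "('r, 'a) ring_scheme \<Rightarrow> ('g, 'b) monoid_scheme \<Rightarrow> 'r \<Rightarrow> 'g \<Rightarrow> 'r" where
  "gr_scalar R G \<equiv> gr_monom R G \<one>\<^bsub>G\<^esub>"

text \<open>The submodule \<open>I RG\<close> of \<open>RG\<close> generated by all products \<open>a x\<close> with \<open>a \<in> I\<close>, \<open>x \<in> RG\<close>.\<close>

definition ideal_gr :: "('r, 'a) ring_scheme \<Rightarrow> ('g, 'b) monoid_scheme \<Rightarrow> 'r set \<Rightarrow> ('g \<Rightarrow> 'r) set" where
  "ideal_gr R G I = ideal_prod (group_ring R G) (gr_scalar R G ` I) (carrier (group_ring R G))"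

section \<open>Left modules\<close>

text \<open>The library's \<open>module\<close> is restricted to commutative rings of scalars.\<close>

locale left_module = S?: ring S + M?: abelian_group M
  for S :: "('s, 'a) ring_scheme" (structure) and M :: "('s, 'm, 'b) module_scheme" (structure) +
  assumes smult_closed [simp, intro]:
      "\<lbrakk>a \<in> carrier S; x \<in> carrier M\<rbrakk> \<Longrightarrow> a \<odot>\<^bsub>M\<^esub> x \<in> carrier M"
    and smult_l_distr:
      "\<lbrakk>a \<in> carrier S; b \<in> carrier S; x \<in> carrier M\<rbrakk> \<Longrightarrow>
        (a \<oplus>\<^bsub>S\<^esub> b) \<odot>\<^bsub>M\<^esub> x = a \<odot>\<^bsub>M\<^esub> x \<oplus>\<^bsub>M\<^esub> b \<odot>\<^bsub>M\<^esub> x"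
    and smult_r_distr:
      "\<lbrakk>a \<in> carrier S; x \<in> carrier M; y \<in> carrier M\<rbrakk> \<Longrightarrow>
        a \<odot>\<^bsub>M\<^esub> (x \<oplus>\<^bsub>M\<^esub> y) = a \<odot>\<^bsub>M\<^esub> x \<oplus>\<^bsub>M\<^esub> a \<odot>\<^bsub>M\<^esub> y"
    and smult_assoc:
      "\<lbrakk>a \<in> carrier S; b \<in> carrier S; x \<in> carrier M\<rbrakk> \<Longrightarrow>
        (a \<otimes>\<^bsub>S\<^esub> b) \<odot>\<^bsub>M\<^esub> x = a \<odot>\<^bsub>M\<^esub> (b \<odot>\<^bsub>M\<^esub> x)"
    and smult_one [simp]: "x \<in> carrier M \<Longrightarrow> \<one>\<^bsub>S\<^esub> \<odot>\<^bsub>M\<^esub> x = x"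

definition mod_hom ::
    "('s, 'a) ring_scheme \<Rightarrow> ('s, 'm, 'b) module_scheme \<Rightarrow> ('s, 'n, 'c) module_scheme \<Rightarrow> ('m \<Rightarrow> 'n) set" where
  "mod_hom S M N = {f \<in> carrier M \<rightarrow> carrier N.
     (\<forall>x\<in>carrier M. \<forall>y\<in>carrier M. f (x \<oplus>\<^bsub>M\<^esub> y) = f x \<oplus>\<^bsub>N\<^esub> f y) \<and>
     (\<forall>a\<in>carrier S. \<forall>x\<in>carrier M. f (a \<odot>\<^bsub>M\<^esub> x) = a \<odot>\<^bsub>N\<^esub> f x)}"

definition short_exact ::
    "('s, 'a) ring_scheme \<Rightarrow> ('s, 'm, 'b) module_scheme \<Rightarrow> ('m \<Rightarrow> 'n) \<Rightarrow> ('s, 'n, 'c) module_scheme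
      \<Rightarrow> ('n \<Rightarrow> 'k) \<Rightarrow> ('s, 'k, 'd) module_scheme \<Rightarrow> bool" where
  "short_exact S M \<iota> N \<phi> K \<longleftrightarrow>
     left_module S M \<and> left_module S N \<and> left_module S K \<and>
     \<iota> \<in> mod_hom S M N \<and> \<phi> \<in> mod_hom S N K \<and>
     inj_on \<iota> (carrier M) \<and>
     \<iota> ` carrier M = {x \<in> carrier N. \<phi> x = \<zero>\<^bsub>K\<^esub>} \<and>
     \<phi> ` carrier N = carrier K"

text \<open>An \<open>RG\<close>-module regarded as an \<open>R\<close>-module.\<close>

definition restrict_scalars ::
    "('r, 'a) ring_scheme \<Rightarrow> ('g, 'b) monoid_scheme \<Rightarrow> ('g \<Rightarrow> 'r, 'n, 'c) module_scheme \<Rightarrow> ('r, 'n) module" where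
  "restrict_scalars R G N =
    \<lparr>carrier = carrier N, mult = mult N, one = one N, zero = zero N, add = add N,
     smult = (\<lambda>r x. gr_scalar R G r \<odot>\<^bsub>N\<^esub> x)\<rparr>"

section \<open>Group codes\<close>

locale left_ideal = S?: ring S + additive_subgroup I S for I and S (structure) +
  assumes l_closed: "\<lbrakk>a \<in> carrier S; x \<in> I\<rbrakk> \<Longrightarrow> a \<otimes> x \<in> I"

definition group_code :: "('r, 'a) ring_scheme \<Rightarrow> ('g, 'b) monoid_scheme \<Rightarrow> ('g \<Rightarrow> 'r) set \<Rightarrow> bool" where
  "group_code R G C \<longleftrightarrow> left_ideal C (group_ring R G)"

definition module_of_code ::
    "('r, 'a) ring_scheme \<Rightarrow> ('g, 'b) monoid_scheme \<Rightarrow> ('g \<Rightarrow> 'r) set \<Rightarrow> ('g \<Rightarrow> 'r, 'g \<Rightarrow> 'r) module" where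
  "module_of_code R G C =
    \<lparr>carrier = C, mult = mult (group_ring R G), one = one (group_ring R G),
     zero = zero (group_ring R G), add = add (group_ring R G), smult = mult (group_ring R G)\<rparr>"

text \<open>Relative projectivity, tested on modules whose elements have the type \<open>'n\<close>.\<close>

definition relative_projective_on ::
    "'n itself \<Rightarrow> ('r, 'a) ring_scheme \<Rightarrow> ('g, 'b) monoid_scheme \<Rightarrow> ('g \<Rightarrow> 'r) set \<Rightarrow> bool" where
  "relative_projective_on _ R G C \<longleftrightarrow>
    (\<forall>(M :: ('g \<Rightarrow> 'r, 'n) module) (N :: ('g \<Rightarrow> 'r, 'n) module) \<iota> \<phi>.
       short_exact (group_ring R G) M \<iota> N \<phi> (module_of_code R G C) \<longrightarrow>
       (\<exists>\<psi>\<in>mod_hom R (restrict_scalars R G (module_of_code R G C)) (restrict_scalars R G N).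
          \<forall>c\<in>C. \<phi> (\<psi> c) = c) \<longrightarrow>
       (\<exists>\<psi>'\<in>mod_hom (group_ring R G) (module_of_code R G C) N. \<forall>c\<in>C. \<phi> (\<psi>' c) = c))"

text \<open>
  HOL cannot quantify over the type of the elements of a module. The type below contains the
  induced module of \<open>C\<close>, and \<open>relative_projective_universal\<close> at the end of this theory shows that
  splitting on this type implies splitting for modules over every other type.
\<close>

definition relative_projective ::
    "('r, 'a) ring_scheme \<Rightarrow> ('g, 'b) monoid_scheme \<Rightarrow> ('g \<Rightarrow> 'r) set \<Rightarrow> bool" where
  "relative_projective R G C \<longleftrightarrow> relative_projective_on TYPE('g \<Rightarrow> 'g \<Rightarrow> 'r) R G C"

text \<open>
  The map from cosets of \<open>m\<^sup>j\<^sup>+\<^sup>1 RG\<close> in \<open>m\<^sup>j RG\<close> to \<open>FG\<close>, where \<open>F = R Quot m\<close>: a coefficient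
  \<open>\<pi>\<^sup>j r\<close> is sent to \<open>r + m\<close>. This is independent of the representative and of \<open>r\<close> as
  long as \<open>j\<close> is smaller than the length of \<open>R\<close>.
\<close>

definition chain_iso ::
    "('r, 'a) ring_scheme \<Rightarrow> ('g, 'b) monoid_scheme \<Rightarrow> 'r \<Rightarrow> 'r set \<Rightarrow> nat \<Rightarrow> ('g \<Rightarrow> 'r) set \<Rightarrow> 'g \<Rightarrow> 'r set" where
  "chain_iso R G \<pi> m j X =
    (\<lambda>g\<in>carrier G. THE c. \<exists>x\<in>X. \<exists>r\<in>carrier R.
       x g = \<pi> [^]\<^bsub>R\<^esub> j \<otimes>\<^bsub>R\<^esub> r \<and> c = m +>\<^bsub>R\<^esub> r)"

definition chain_code ::
    "('r, 'a) ring_scheme \<Rightarrow> ('g, 'b) monoid_scheme \<Rightarrow> 'r \<Rightarrow> 'r set \<Rightarrow> ('g \<Rightarrow> 'r) set \<Rightarrow> nat \<Rightarrow> ('g \<Rightarrow> 'r set) set" where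
  "chain_code R G \<pi> m C j =
    chain_iso R G \<pi> m j `
      (\<lambda>x. ideal_gr R G (ideal_power R m (Suc j)) +>\<^bsub>group_ring R G\<^esub> x) `
        (C \<inter> ideal_gr R G (ideal_power R m j))"

definition hamming_weight :: "('r, 'a) ring_scheme \<Rightarrow> ('g, 'b) monoid_scheme \<Rightarrow> ('g \<Rightarrow> 'r) \<Rightarrow> nat" where
  "hamming_weight R G c = card {g \<in> carrier G. c g \<noteq> \<zero>\<^bsub>R\<^esub>}"

text \<open>The infimum is attained unless \<open>C\<close> is zero, and then it is \<open>\<infinity>\<close>.\<close>

definition min_distance :: "('r, 'a) ring_scheme \<Rightarrow> ('g, 'b) monoid_scheme \<Rightarrow> ('g \<Rightarrow> 'r) set \<Rightarrow> enat" where
  "min_distance R G C = (INF c \<in> C - {\<zero>\<^bsub>group_ring R G\<^esub>}. enat (hamming_weight R G c))"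

section \<open>Relative projectivity does not depend on the type of the test modules\<close>

lemma (in abelian_monoid) finsum_swap:
  assumes "finite A" "finite B" "\<And>a b. \<lbrakk>a \<in> A; b \<in> B\<rbrakk> \<Longrightarrow> f a b \<in> carrier G"
  shows "(\<Oplus>a\<in>A. \<Oplus>b\<in>B. f a b) = (\<Oplus>b\<in>B. \<Oplus>a\<in>A. f a b)"
  using assms(1,3)
proof (induction A)
  case empty
  then show ?case by simp
next
  case (insert x A)
  have "(\<Oplus>a\<in>insert x A. \<Oplus>b\<in>B. f a b) = (\<Oplus>b\<in>B. f x b) \<oplus> (\<Oplus>b\<in>B. \<Oplus>a\<in>A. f a b)"
    using insert by (subst finsum_insert) (auto intro!: finsum_closed)
  also have "\<dots> = (\<Oplus>b\<in>B. f x b \<oplus> (\<Oplus>a\<in>A. f a b))"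
    using insert.prems by (subst finsum_addf) (auto intro!: finsum_closed)
  also have "\<dots> = (\<Oplus>b\<in>B. \<Oplus>a\<in>insert x A. f a b)"
    using insert by (intro finsum_cong' refl) (auto intro!: finsum_closed)
  finally show ?case .
qed

lemma mod_homD:
  assumes "f \<in> mod_hom S M N"
  shows "x \<in> carrier M \<Longrightarrow> f x \<in> carrier N"
    and "\<lbrakk>x \<in> carrier M; y \<in> carrier M\<rbrakk> \<Longrightarrow> f (x \<oplus>\<^bsub>M\<^esub> y) = f x \<oplus>\<^bsub>N\<^esub> f y"
    and "\<lbrakk>a \<in> carrier S; x \<in> carrier M\<rbrakk> \<Longrightarrow> f (a \<odot>\<^bsub>M\<^esub> x) = a \<odot>\<^bsub>N\<^esub> f x"
  using assms by (auto simp: mod_hom_def)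

lemma additive_map_zero:
  assumes "abelian_group M" "abelian_group N" "f \<in> carrier M \<rightarrow> carrier N"
    and "\<And>x y. \<lbrakk>x \<in> carrier M; y \<in> carrier M\<rbrakk> \<Longrightarrow> f (x \<oplus>\<^bsub>M\<^esub> y) = f x \<oplus>\<^bsub>N\<^esub> f y"
  shows "f \<zero>\<^bsub>M\<^esub> = \<zero>\<^bsub>N\<^esub>"
proof -
  interpret M: abelian_group M by fact
  interpret N: abelian_group N by fact
  have "f \<zero>\<^bsub>M\<^esub> = f \<zero>\<^bsub>M\<^esub> \<oplus>\<^bsub>N\<^esub> f \<zero>\<^bsub>M\<^esub>"
    using assms(4)[of "\<zero>\<^bsub>M\<^esub>" "\<zero>\<^bsub>M\<^esub>"] by simp
  moreover have "f \<zero>\<^bsub>M\<^esub> \<in> carrier N" using assms(3) by auto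
  ultimately show ?thesis by (metis N.add.r_cancel_one')
qed

lemma additive_map_finsum:
  assumes "abelian_group M" "abelian_group N" "f \<in> carrier M \<rightarrow> carrier N"
    and "\<And>x y. \<lbrakk>x \<in> carrier M; y \<in> carrier M\<rbrakk> \<Longrightarrow> f (x \<oplus>\<^bsub>M\<^esub> y) = f x \<oplus>\<^bsub>N\<^esub> f y"
    and "finite A" "h \<in> A \<rightarrow> carrier M"
  shows "f (\<Oplus>\<^bsub>M\<^esub>i\<in>A. h i) = (\<Oplus>\<^bsub>N\<^esub>i\<in>A. f (h i))"
proof -
  interpret M: abelian_group M by fact
  interpret N: abelian_group N by fact
  show ?thesis using assms(5,6)
  proof (induction A)
    case empty
    then show ?case using additive_map_zero[OF assms(1-4)] by simp
  next
    case (insert x A)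
    have "f (\<Oplus>\<^bsub>M\<^esub>i\<in>insert x A. h i) = f (h x \<oplus>\<^bsub>M\<^esub> (\<Oplus>\<^bsub>M\<^esub>i\<in>A. h i))"
      using insert by (subst M.finsum_insert) auto
    also have "\<dots> = f (h x) \<oplus>\<^bsub>N\<^esub> (\<Oplus>\<^bsub>N\<^esub>i\<in>A. f (h i))"
      using insert by (subst assms(4)) auto
    also have "\<dots> = (\<Oplus>\<^bsub>N\<^esub>i\<in>insert x A. f (h i))"
      using insert assms(3) by (subst N.finsum_insert) auto
    finally show ?case .
  qed
qed

lemma (in left_module) smult_finsum:
  assumes "finite A" "a \<in> carrier S" "f \<in> A \<rightarrow> carrier M"
  shows "a \<odot>\<^bsub>M\<^esub> (\<Oplus>\<^bsub>M\<^esub>i\<in>A. f i) = (\<Oplus>\<^bsub>M\<^esub>i\<in>A. a \<odot>\<^bsub>M\<^esub> f i)"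
  using assms
  by (intro additive_map_finsum M.abelian_group_axioms) (auto intro: smult_r_distr)

lemma (in left_module) finsum_smult:
  assumes "finite A" "f \<in> A \<rightarrow> carrier S" "x \<in> carrier M"
  shows "(\<Oplus>\<^bsub>S\<^esub>i\<in>A. f i) \<odot>\<^bsub>M\<^esub> x = (\<Oplus>\<^bsub>M\<^esub>i\<in>A. f i \<odot>\<^bsub>M\<^esub> x)"
  using assms
  by (intro additive_map_finsum[where f = "\<lambda>a. a \<odot>\<^bsub>M\<^esub> x"] M.abelian_group_axioms S.abelian_group_axioms)
     (auto intro: smult_l_distr)

lemma (in group) inv_mult_mult [simp]:
  assumes "h \<in> carrier G" "k \<in> carrier G"
  shows "inv h \<otimes> (h \<otimes> k) = k" "h \<otimes> (inv h \<otimes> k) = k"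
  using assms by (simp_all flip: m_assoc)

lemma (in group) translate_bij: "h \<in> carrier G \<Longrightarrow> bij_betw (\<lambda>k. h \<otimes> k) (carrier G) (carrier G)"
  by (rule bij_betwI[where g = "\<lambda>k. inv h \<otimes> k"]) auto

lemma (in abelian_monoid) finsum_translate:
  assumes "Group.group H" "h \<in> carrier H" "f \<in> carrier H \<rightarrow> carrier G"
  shows "(\<Oplus>k\<in>carrier H. f k) = (\<Oplus>k\<in>carrier H. f (h \<otimes>\<^bsub>H\<^esub> k))"
proof -
  have b: "bij_betw (\<lambda>k. h \<otimes>\<^bsub>H\<^esub> k) (carrier H) (carrier H)"
    using assms by (simp add: group.translate_bij)
  show ?thesis
    using finsum_reindex[of f "\<lambda>k. h \<otimes>\<^bsub>H\<^esub> k" "carrier H"] assms(3) b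
    by (simp add: bij_betw_def)
qed

definition gr_conv :: "('g, 'b) monoid_scheme \<Rightarrow> ('r, 'v, 'c) module_scheme \<Rightarrow> ('g \<Rightarrow> 'r) \<Rightarrow> ('g \<Rightarrow> 'v) \<Rightarrow> 'g \<Rightarrow> 'v" where
  "gr_conv G V a f = (\<lambda>g\<in>carrier G. \<Oplus>\<^bsub>V\<^esub>h\<in>carrier G. a h \<odot>\<^bsub>V\<^esub> f (inv\<^bsub>G\<^esub> h \<otimes>\<^bsub>G\<^esub> g))"

text \<open>The induced module of an \<open>R\<close>-module \<open>V\<close>; the function \<open>f\<close> stands for the sum of all \<open>g \<otimes> f g\<close>.\<close>

definition induced_module :: "('g, 'b) monoid_scheme \<Rightarrow> ('r, 'v, 'c) module_scheme \<Rightarrow> ('g \<Rightarrow> 'r, 'g \<Rightarrow> 'v) module" where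
  "induced_module G V =
    \<lparr>carrier = carrier G \<rightarrow>\<^sub>E carrier V, mult = undefined, one = undefined,
     zero = (\<lambda>g\<in>carrier G. \<zero>\<^bsub>V\<^esub>), add = (\<lambda>x y. \<lambda>g\<in>carrier G. x g \<oplus>\<^bsub>V\<^esub> y g),
     smult = gr_conv G V\<rparr>"

definition regular_module :: "('r, 'a) ring_scheme \<Rightarrow> ('r, 'r) module" where
  "regular_module R =
    \<lparr>carrier = carrier R, mult = mult R, one = one R, zero = zero R, add = add R, smult = mult R\<rparr>"

lemma gr_conv_extensional [simp]: "gr_conv G V a f \<in> extensional (carrier G)"
  by (simp add: gr_conv_def)

lemma (in cring) regular_module: "Module.module R (regular_module R)"
proof (rule moduleI)
  show "abelian_group (regular_module R)"
    by (rule abelian_groupI) (auto simp: regular_module_def a_ac intro: l_neg)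
qed (auto simp: regular_module_def l_distr r_distr m_assoc is_cring)

lemma (in cring) finsum_regular_module:
  assumes "finite A" "f \<in> A \<rightarrow> carrier R"
  shows "finsum (regular_module R) f A = finsum R f A"
proof -
  interpret V: Module.module R "regular_module R" by (rule regular_module)
  show ?thesis
    using additive_map_finsum[OF abelian_group_axioms V.M.abelian_group_axioms, of "\<lambda>x. x" A f] assms
    by (simp add: regular_module_def)
qed

locale fin_group_ring = R?: cring R + G?: group G
  for R :: "('r, 'a) ring_scheme" (structure) and G :: "('g, 'b) monoid_scheme" (structure) +
  assumes finite_G: "finite (carrier G)"
begin

abbreviation "RG \<equiv> group_ring R G"

lemma gr_carrier: "carrier RG = carrier G \<rightarrow>\<^sub>E carrier R"
  by (simp add: group_ring_def)

lemma gr_coeff: "x \<in> carrier RG \<Longrightarrow> g \<in> carrier G \<Longrightarrow> x g \<in> carrier R"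
  by (auto simp: gr_carrier)

lemma gr_mult_eq_conv:
  assumes "x \<in> carrier RG" "y \<in> carrier RG"
  shows "x \<otimes>\<^bsub>RG\<^esub> y = gr_conv G (regular_module R) x y"
proof (rule extensionalityI[of _ "carrier G"])
  fix g assume g: "g \<in> carrier G"
  have "(\<lambda>h. x h \<otimes> y (inv\<^bsub>G\<^esub> h \<otimes>\<^bsub>G\<^esub> g)) \<in> carrier G \<rightarrow> carrier R"
    using g assms by (simp add: Pi_def gr_coeff)
  from finsum_regular_module[OF finite_G this]
  show "(x \<otimes>\<^bsub>RG\<^esub> y) g = gr_conv G (regular_module R) x y g"
    using g by (simp add: group_ring_def gr_conv_def) (simp add: regular_module_def)
qed (auto simp: group_ring_def gr_conv_def)

lemma gr_monom_closed [simp]: "r \<in> carrier R \<Longrightarrow> gr_monom R G g r \<in> carrier RG"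
  by (simp add: gr_carrier gr_monom_def)

lemma gr_add_closed: "x \<in> carrier RG \<Longrightarrow> y \<in> carrier RG \<Longrightarrow> x \<oplus>\<^bsub>RG\<^esub> y \<in> carrier RG"
  by (auto simp: group_ring_def)

lemma gr_one: "\<one>\<^bsub>RG\<^esub> = gr_monom R G \<one>\<^bsub>G\<^esub> \<one>"
  by (simp add: group_ring_def gr_monom_def)

context
  fixes V :: "('r, 'v, 'c) module_scheme"
  assumes V: "Module.module R V"
begin

interpretation V: Module.module R V by (rule V)

lemma conv_closed:
  assumes "a \<in> carrier RG" "f \<in> carrier G \<rightarrow>\<^sub>E carrier V"
  shows "gr_conv G V a f \<in> carrier G \<rightarrow>\<^sub>E carrier V"
  using assms by (auto simp: gr_conv_def gr_carrier intro!: V.finsum_closed V.smult_closed)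

lemma conv_add_right:
  assumes "a \<in> carrier RG" "f \<in> carrier G \<rightarrow>\<^sub>E carrier V" "f' \<in> carrier G \<rightarrow>\<^sub>E carrier V"
  shows "gr_conv G V a (\<lambda>g\<in>carrier G. f g \<oplus>\<^bsub>V\<^esub> f' g)
    = (\<lambda>g\<in>carrier G. gr_conv G V a f g \<oplus>\<^bsub>V\<^esub> gr_conv G V a f' g)"
proof (rule extensionalityI[of _ "carrier G"])
  fix g assume g: "g \<in> carrier G"
  have mem: "a h \<in> carrier R" "f (inv\<^bsub>G\<^esub> h \<otimes>\<^bsub>G\<^esub> g) \<in> carrier V" "f' (inv\<^bsub>G\<^esub> h \<otimes>\<^bsub>G\<^esub> g) \<in> carrier V"
    if "h \<in> carrier G" for h
    using that g assms gr_coeff by (auto simp: PiE_mem)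
  show "gr_conv G V a (\<lambda>g\<in>carrier G. f g \<oplus>\<^bsub>V\<^esub> f' g) g
    = (\<lambda>g\<in>carrier G. gr_conv G V a f g \<oplus>\<^bsub>V\<^esub> gr_conv G V a f' g) g"
    unfolding gr_conv_def restrict_apply'[OF g]
    by (subst V.finsum_addf[symmetric], (use mem in \<open>auto simp: Pi_def\<close>)[2], rule V.finsum_cong'[OF refl])
       (use g mem in \<open>simp_all add: Pi_def V.smult_r_distr\<close>)
qed (auto simp: gr_conv_def)

lemma conv_add_left:
  assumes "a \<in> carrier RG" "b \<in> carrier RG" "f \<in> carrier G \<rightarrow>\<^sub>E carrier V"
  shows "gr_conv G V (a \<oplus>\<^bsub>RG\<^esub> b) f
    = (\<lambda>g\<in>carrier G. gr_conv G V a f g \<oplus>\<^bsub>V\<^esub> gr_conv G V b f g)"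
proof (rule extensionalityI[of _ "carrier G"])
  fix g assume g: "g \<in> carrier G"
  have mem: "a h \<in> carrier R" "b h \<in> carrier R" "f (inv\<^bsub>G\<^esub> h \<otimes>\<^bsub>G\<^esub> g) \<in> carrier V"
    if "h \<in> carrier G" for h
    using that g assms gr_coeff by (auto simp: PiE_mem)
  show "gr_conv G V (a \<oplus>\<^bsub>RG\<^esub> b) f g
    = (\<lambda>g\<in>carrier G. gr_conv G V a f g \<oplus>\<^bsub>V\<^esub> gr_conv G V b f g) g"
    unfolding gr_conv_def restrict_apply'[OF g]
    by (subst V.finsum_addf[symmetric], (use mem in \<open>auto simp: Pi_def\<close>)[2], rule V.finsum_cong'[OF refl])
       (use g mem in \<open>simp_all add: Pi_def V.smult_l_distr group_ring_def\<close>)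
qed (auto simp: gr_conv_def)

lemma conv_monom:
  assumes "r \<in> carrier R" "h \<in> carrier G" "f \<in> carrier G \<rightarrow>\<^sub>E carrier V" "g \<in> carrier G"
  shows "gr_conv G V (gr_monom R G h r) f g = r \<odot>\<^bsub>V\<^esub> f (inv\<^bsub>G\<^esub> h \<otimes>\<^bsub>G\<^esub> g)"
proof -
  let ?F = "\<lambda>k. r \<odot>\<^bsub>V\<^esub> f (inv\<^bsub>G\<^esub> k \<otimes>\<^bsub>G\<^esub> g)"
  have f: "f (inv\<^bsub>G\<^esub> k \<otimes>\<^bsub>G\<^esub> g) \<in> carrier V" if "k \<in> carrier G" for k
    using assms that by (auto intro!: PiE_mem[of f "carrier G"])
  then have F: "?F \<in> carrier G \<rightarrow> carrier V"
    using assms by auto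
  have "gr_conv G V (gr_monom R G h r) f g = (\<Oplus>\<^bsub>V\<^esub>k\<in>carrier G. if h = k then ?F k else \<zero>\<^bsub>V\<^esub>)"
    using assms(4) F f unfolding gr_conv_def gr_monom_def
    by (simp, intro V.finsum_cong' refl) (auto simp: f)
  also have "\<dots> = ?F h"
    using assms F finite_G by (intro V.finsum_singleton)
  finally show ?thesis .
qed

lemma conv_one:
  assumes "f \<in> carrier G \<rightarrow>\<^sub>E carrier V"
  shows "gr_conv G V \<one>\<^bsub>RG\<^esub> f = f"
proof (rule extensionalityI[of _ "carrier G"])
  fix g assume g: "g \<in> carrier G"
  then have "f g \<in> carrier V" using assms by auto
  with g show "gr_conv G V \<one>\<^bsub>RG\<^esub> f g = f g"
    using assms by (simp add: gr_one conv_monom)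
qed (use assms in \<open>simp_all add: PiE_iff\<close>)

lemma conv_assoc:
  assumes "a \<in> carrier RG" "b \<in> carrier RG" "f \<in> carrier G \<rightarrow>\<^sub>E carrier V"
  shows "gr_conv G V (a \<otimes>\<^bsub>RG\<^esub> b) f = gr_conv G V a (gr_conv G V b f)"
proof (rule extensionalityI[of _ "carrier G"])
  fix g assume g: "g \<in> carrier G"
  have a: "a h \<in> carrier R" if "h \<in> carrier G" for h
    using that assms gr_coeff by auto
  have b: "b h \<in> carrier R" if "h \<in> carrier G" for h
    using that assms gr_coeff by auto
  have f: "f h \<in> carrier V" if "h \<in> carrier G" for h
    using that assms by auto
  let ?t = "\<lambda>h k. a h \<odot>\<^bsub>V\<^esub> (b (inv\<^bsub>G\<^esub> h \<otimes>\<^bsub>G\<^esub> k) \<odot>\<^bsub>V\<^esub> f (inv\<^bsub>G\<^esub> k \<otimes>\<^bsub>G\<^esub> g))"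
  have smult_sum: "(\<Oplus>h\<in>A. F h) \<odot>\<^bsub>V\<^esub> x = (\<Oplus>\<^bsub>V\<^esub>h\<in>A. F h \<odot>\<^bsub>V\<^esub> x)"
    if "finite A" "F \<in> A \<rightarrow> carrier R" "x \<in> carrier V" for F :: "'g \<Rightarrow> 'r" and A x
    using that
    by (intro additive_map_finsum[where f = "\<lambda>a. a \<odot>\<^bsub>V\<^esub> x"] V.M.abelian_group_axioms R.abelian_group_axioms)
       (auto intro: V.smult_l_distr)
  have "gr_conv G V (a \<otimes>\<^bsub>RG\<^esub> b) f g
      = (\<Oplus>\<^bsub>V\<^esub>k\<in>carrier G. (\<Oplus>h\<in>carrier G. a h \<otimes> b (inv\<^bsub>G\<^esub> h \<otimes>\<^bsub>G\<^esub> k)) \<odot>\<^bsub>V\<^esub> f (inv\<^bsub>G\<^esub> k \<otimes>\<^bsub>G\<^esub> g))"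
    using g a b f
    by (auto simp: gr_conv_def group_ring_def intro!: V.finsum_cong' V.smult_closed R.finsum_closed)
  also have "\<dots> = (\<Oplus>\<^bsub>V\<^esub>k\<in>carrier G. \<Oplus>\<^bsub>V\<^esub>h\<in>carrier G. ?t h k)"
    using g a b f finite_G
    by (auto simp: smult_sum Pi_def V.smult_assoc1 intro!: V.finsum_cong' V.finsum_closed)
  also have "\<dots> = (\<Oplus>\<^bsub>V\<^esub>h\<in>carrier G. \<Oplus>\<^bsub>V\<^esub>k\<in>carrier G. ?t h k)"
    using g a b f finite_G by (intro V.finsum_swap) auto
  also have "\<dots> = (\<Oplus>\<^bsub>V\<^esub>h\<in>carrier G. \<Oplus>\<^bsub>V\<^esub>k\<in>carrier G. a h \<odot>\<^bsub>V\<^esub> (b k \<odot>\<^bsub>V\<^esub> f (inv\<^bsub>G\<^esub> k \<otimes>\<^bsub>G\<^esub> (inv\<^bsub>G\<^esub> h \<otimes>\<^bsub>G\<^esub> g))))"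
  proof (rule V.finsum_cong'[OF refl])
    fix h assume h: "h \<in> carrier G"
    show "(\<Oplus>\<^bsub>V\<^esub>k\<in>carrier G. ?t h k)
      = (\<Oplus>\<^bsub>V\<^esub>k\<in>carrier G. a h \<odot>\<^bsub>V\<^esub> (b k \<odot>\<^bsub>V\<^esub> f (inv\<^bsub>G\<^esub> k \<otimes>\<^bsub>G\<^esub> (inv\<^bsub>G\<^esub> h \<otimes>\<^bsub>G\<^esub> g))))"
    proof -
      have "(\<Oplus>\<^bsub>V\<^esub>k\<in>carrier G. ?t h k) = (\<Oplus>\<^bsub>V\<^esub>k\<in>carrier G. ?t h (h \<otimes>\<^bsub>G\<^esub> k))"
        by (rule V.finsum_translate[OF G.group_axioms h]) (use g h a b f in auto)
      also have "\<dots> = (\<Oplus>\<^bsub>V\<^esub>k\<in>carrier G. a h \<odot>\<^bsub>V\<^esub> (b k \<odot>\<^bsub>V\<^esub> f (inv\<^bsub>G\<^esub> k \<otimes>\<^bsub>G\<^esub> (inv\<^bsub>G\<^esub> h \<otimes>\<^bsub>G\<^esub> g))))"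
        by (rule V.finsum_cong') (use g h a b f in \<open>simp_all add: G.inv_mult_group G.m_assoc\<close>)
      finally show ?thesis .
    qed
  qed (use g a b f in \<open>simp_all add: Pi_def V.finsum_closed\<close>)
  also have "\<dots> = (\<Oplus>\<^bsub>V\<^esub>h\<in>carrier G. a h \<odot>\<^bsub>V\<^esub> (\<Oplus>\<^bsub>V\<^esub>k\<in>carrier G. b k \<odot>\<^bsub>V\<^esub> f (inv\<^bsub>G\<^esub> k \<otimes>\<^bsub>G\<^esub> (inv\<^bsub>G\<^esub> h \<otimes>\<^bsub>G\<^esub> g))))"
    using g a b f finite_G
    by (auto simp: V.finsum_smult_ldistr Pi_def intro!: V.finsum_cong' V.finsum_closed)
  also have "\<dots> = gr_conv G V a (gr_conv G V b f) g"
    unfolding gr_conv_def restrict_apply'[OF g]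
    by (rule V.finsum_cong'[OF refl]) (use g a b f in \<open>simp_all add: Pi_def\<close>)
  finally show "gr_conv G V (a \<otimes>\<^bsub>RG\<^esub> b) f g = gr_conv G V a (gr_conv G V b f) g" .
qed (auto simp: gr_conv_def)

lemma abelian_group_funcs:
  assumes "carrier N = carrier G \<rightarrow>\<^sub>E carrier V" "\<zero>\<^bsub>N\<^esub> = (\<lambda>g\<in>carrier G. \<zero>\<^bsub>V\<^esub>)"
    and "\<And>x y. x \<oplus>\<^bsub>N\<^esub> y = (\<lambda>g\<in>carrier G. x g \<oplus>\<^bsub>V\<^esub> y g)"
  shows "abelian_group N"
proof (rule abelian_groupI)
  fix x assume x: "x \<in> carrier N"
  then have "x g \<in> carrier V" if "g \<in> carrier G" for g
    using that by (auto simp: assms)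
  then show "\<exists>y\<in>carrier N. y \<oplus>\<^bsub>N\<^esub> x = \<zero>\<^bsub>N\<^esub>"
    by (intro bexI[of _ "\<lambda>g\<in>carrier G. \<ominus>\<^bsub>V\<^esub> x g"]) (auto simp: assms V.l_neg)
  show "\<zero>\<^bsub>N\<^esub> \<oplus>\<^bsub>N\<^esub> x = x"
    using x by (auto simp: assms fun_eq_iff PiE_def extensional_def Pi_def)
next
  fix x y z assume xyz: "x \<in> carrier N" "y \<in> carrier N" "z \<in> carrier N"
  then have "x g \<in> carrier V" "y g \<in> carrier V" "z g \<in> carrier V" if "g \<in> carrier G" for g
    using that by (auto simp: assms)
  then show "x \<oplus>\<^bsub>N\<^esub> y \<oplus>\<^bsub>N\<^esub> z = x \<oplus>\<^bsub>N\<^esub> (y \<oplus>\<^bsub>N\<^esub> z)"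
    by (simp add: assms fun_eq_iff V.a_assoc)
next
  fix x y assume "x \<in> carrier N" "y \<in> carrier N"
  then have "x g \<in> carrier V" "y g \<in> carrier V" if "g \<in> carrier G" for g
    using that by (auto simp: assms)
  then show "x \<oplus>\<^bsub>N\<^esub> y = y \<oplus>\<^bsub>N\<^esub> x" "x \<oplus>\<^bsub>N\<^esub> y \<in> carrier N"
    by (simp_all add: assms fun_eq_iff V.a_comm)
qed (auto simp: assms)

end

lemma ring_group_ring: "ring RG"
proof -
  note V = regular_module
  have car: "carrier (regular_module R) = carrier R" by (simp add: regular_module_def)
  have add: "x \<oplus>\<^bsub>regular_module R\<^esub> y = x \<oplus> y" for x y by (simp add: regular_module_def)
  have gradd: "x \<oplus>\<^bsub>RG\<^esub> y = (\<lambda>g\<in>carrier G. x g \<oplus> y g)" for x y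
    by (simp add: group_ring_def)
  have one: "x \<otimes>\<^bsub>RG\<^esub> \<one>\<^bsub>RG\<^esub> = x" if x: "x \<in> carrier RG" for x
  proof (rule extensionalityI[of _ "carrier G"])
    fix g assume g: "g \<in> carrier G"
    have "(x \<otimes>\<^bsub>RG\<^esub> \<one>\<^bsub>RG\<^esub>) g = (\<Oplus>h\<in>carrier G. if g = h then x h else \<zero>)"
      using g x gr_coeff[OF x]
      by (auto simp: group_ring_def G.inv_equality G.inv_solve_left' intro!: R.finsum_cong')
    also have "\<dots> = x g"
      using g gr_coeff[OF x] finite_G by (intro R.finsum_singleton) auto
    finally show "(x \<otimes>\<^bsub>RG\<^esub> \<one>\<^bsub>RG\<^esub>) g = x g" .
  qed (use x in \<open>simp_all add: gr_carrier PiE_iff, simp add: group_ring_def\<close>)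
  show ?thesis
  proof (rule ringI)
    show "abelian_group RG"
      by (rule abelian_group_funcs[OF V]) (simp_all add: group_ring_def regular_module_def)
    have closed: "x \<otimes>\<^bsub>RG\<^esub> y \<in> carrier RG" if "x \<in> carrier RG" "y \<in> carrier RG" for x y
      using conv_closed[OF V, of x y] that by (simp add: gr_mult_eq_conv gr_carrier car)
    show "Group.monoid RG"
    proof (rule monoidI)
      show one_closed: "\<one>\<^bsub>RG\<^esub> \<in> carrier RG" by (simp add: gr_one)
      show "\<one>\<^bsub>RG\<^esub> \<otimes>\<^bsub>RG\<^esub> x = x" if "x \<in> carrier RG" for x
        using conv_one[OF V, of x] that one_closed by (simp add: gr_mult_eq_conv gr_carrier car)
      show "x \<otimes>\<^bsub>RG\<^esub> y \<otimes>\<^bsub>RG\<^esub> z = x \<otimes>\<^bsub>RG\<^esub> (y \<otimes>\<^bsub>RG\<^esub> z)"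
        if "x \<in> carrier RG" "y \<in> carrier RG" "z \<in> carrier RG" for x y z
      proof -
        have "x \<otimes>\<^bsub>RG\<^esub> y \<otimes>\<^bsub>RG\<^esub> z = gr_conv G (regular_module R) (x \<otimes>\<^bsub>RG\<^esub> y) z"
          using that closed by (intro gr_mult_eq_conv)
        also have "\<dots> = gr_conv G (regular_module R) x (gr_conv G (regular_module R) y z)"
          using that by (intro conv_assoc[OF V]) (simp_all add: gr_carrier car)
        also have "\<dots> = x \<otimes>\<^bsub>RG\<^esub> (y \<otimes>\<^bsub>RG\<^esub> z)"
          using that closed by (simp add: gr_mult_eq_conv)
        finally show ?thesis .
      qed
    qed (use closed one in auto)
  qed (use conv_add_left[OF V] conv_add_right[OF V] gr_add_closed in
      \<open>simp_all add: gr_mult_eq_conv gr_carrier car add gradd\<close>)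
qed

lemma gr_monom_mult:
  assumes "g \<in> carrier G" "h \<in> carrier G" "r \<in> carrier R" "s \<in> carrier R"
  shows "gr_monom R G g r \<otimes>\<^bsub>RG\<^esub> gr_monom R G h s = gr_monom R G (g \<otimes>\<^bsub>G\<^esub> h) (r \<otimes> s)"
proof (rule extensionalityI[of _ "carrier G"])
  fix x assume x: "x \<in> carrier G"
  have eq: "inv\<^bsub>G\<^esub> g \<otimes>\<^bsub>G\<^esub> x = h \<longleftrightarrow> x = g \<otimes>\<^bsub>G\<^esub> h"
    using assms x by auto
  have "(gr_monom R G g r \<otimes>\<^bsub>RG\<^esub> gr_monom R G h s) x
    = r \<otimes> gr_monom R G h s (inv\<^bsub>G\<^esub> g \<otimes>\<^bsub>G\<^esub> x)"
    using conv_monom[OF regular_module, of r g "gr_monom R G h s" x] assms x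
    by (simp add: gr_mult_eq_conv) (simp add: regular_module_def gr_carrier[symmetric])
  also have "\<dots> = gr_monom R G (g \<otimes>\<^bsub>G\<^esub> h) (r \<otimes> s) x"
    using assms x eq by (simp add: gr_monom_def)
  finally show "(gr_monom R G g r \<otimes>\<^bsub>RG\<^esub> gr_monom R G h s) x = gr_monom R G (g \<otimes>\<^bsub>G\<^esub> h) (r \<otimes> s) x" .
qed (simp_all add: group_ring_def gr_monom_def)

lemma gr_monom_add:
  assumes "r \<in> carrier R" "s \<in> carrier R"
  shows "gr_monom R G g (r \<oplus> s) = gr_monom R G g r \<oplus>\<^bsub>RG\<^esub> gr_monom R G g s"
  using assms by (auto simp: group_ring_def gr_monom_def)

lemma gr_finsum_apply:
  assumes "finite A" "F \<in> A \<rightarrow> carrier RG" "g \<in> carrier G"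
  shows "(\<Oplus>\<^bsub>RG\<^esub>i\<in>A. F i) g = (\<Oplus>i\<in>A. F i g)"
proof -
  interpret RG: ring RG by (rule ring_group_ring)
  show ?thesis
    by (rule additive_map_finsum[OF RG.abelian_group_axioms R.abelian_group_axioms, of "\<lambda>x. x g"])
       (use assms in \<open>auto simp: gr_coeff group_ring_def\<close>)
qed

lemma gr_sum_monom:
  assumes "a \<in> carrier RG"
  shows "a = (\<Oplus>\<^bsub>RG\<^esub>h\<in>carrier G. gr_monom R G h (a h))"
proof (rule extensionalityI[of _ "carrier G"])
  interpret RG: ring RG by (rule ring_group_ring)
  have F: "(\<lambda>h. gr_monom R G h (a h)) \<in> carrier G \<rightarrow> carrier RG"
    using gr_coeff[OF assms] by simp
  from assms show "a \<in> extensional (carrier G)" by (simp add: gr_carrier PiE_iff)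
  from RG.finsum_closed[OF F] show "(\<Oplus>\<^bsub>RG\<^esub>h\<in>carrier G. gr_monom R G h (a h)) \<in> extensional (carrier G)"
    by (simp add: gr_carrier PiE_iff)
  fix g assume g: "g \<in> carrier G"
  have "(\<Oplus>\<^bsub>RG\<^esub>h\<in>carrier G. gr_monom R G h (a h)) g = (\<Oplus>h\<in>carrier G. gr_monom R G h (a h) g)"
    by (rule gr_finsum_apply[OF finite_G F g])
  also have "\<dots> = (\<Oplus>h\<in>carrier G. if g = h then a h else \<zero>)"
    by (rule R.finsum_cong'[OF refl]) (use g gr_coeff[OF assms] in \<open>auto simp: gr_monom_def\<close>)
  also have "\<dots> = a g"
    using g gr_coeff[OF assms] finite_G by (intro R.finsum_singleton) auto
  finally show "a g = (\<Oplus>\<^bsub>RG\<^esub>h\<in>carrier G. gr_monom R G h (a h)) g" ..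
qed

lemma restrict_scalars_simps [simp]:
  "carrier (restrict_scalars R G N) = carrier N"
  "x \<oplus>\<^bsub>restrict_scalars R G N\<^esub> y = x \<oplus>\<^bsub>N\<^esub> y"
  "\<zero>\<^bsub>restrict_scalars R G N\<^esub> = \<zero>\<^bsub>N\<^esub>"
  "r \<odot>\<^bsub>restrict_scalars R G N\<^esub> x = gr_monom R G \<one>\<^bsub>G\<^esub> r \<odot>\<^bsub>N\<^esub> x"
  by (simp_all add: restrict_scalars_def)

lemma module_restrict_scalars:
  assumes "left_module RG N"
  shows "Module.module R (restrict_scalars R G N)"
proof -
  interpret N: left_module RG N by fact
  show ?thesis
  proof (rule moduleI)
    show "abelian_group (restrict_scalars R G N)"
      by (rule abelian_groupI) (auto simp: N.a_ac intro: N.M.l_neg)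
    show "cring R" by (rule R.is_cring)
  next
    fix r s x assume rsx: "r \<in> carrier R" "s \<in> carrier R" "x \<in> carrier (restrict_scalars R G N)"
    then show "(r \<otimes> s) \<odot>\<^bsub>restrict_scalars R G N\<^esub> x
        = r \<odot>\<^bsub>restrict_scalars R G N\<^esub> (s \<odot>\<^bsub>restrict_scalars R G N\<^esub> x)"
      using gr_monom_mult[of "\<one>\<^bsub>G\<^esub>" "\<one>\<^bsub>G\<^esub>" r s] by (simp flip: N.smult_assoc)
  qed (simp_all add: gr_monom_add N.smult_l_distr N.smult_r_distr flip: gr_one)
qed

lemma left_module_induced:
  assumes "Module.module R V"
  shows "left_module RG (induced_module G V)"
proof (intro left_module.intro left_module_axioms.intro)
  show "ring RG" by (rule ring_group_ring)
  show "abelian_group (induced_module G V)"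
    by (rule abelian_group_funcs[OF assms]) (simp_all add: induced_module_def)
qed (use conv_closed[OF assms] conv_add_left[OF assms] conv_add_right[OF assms] conv_one[OF assms]
    conv_assoc[OF assms] in \<open>simp_all add: induced_module_def\<close>)

lemma left_module_kernel:
  assumes "left_module S N" "left_module S K" "f \<in> mod_hom S N K"
  shows "left_module S (N\<lparr>carrier := {x \<in> carrier N. f x = \<zero>\<^bsub>K\<^esub>}\<rparr>)" (is "left_module S ?M")
proof -
  interpret N: left_module S N by fact
  interpret K: left_module S K by fact
  note f = mod_homD[OF assms(3)]
  have f0: "f \<zero>\<^bsub>N\<^esub> = \<zero>\<^bsub>K\<^esub>"
    using f by (intro additive_map_zero[OF N.M.abelian_group_axioms K.M.abelian_group_axioms]) auto
  have a0: "a \<odot>\<^bsub>K\<^esub> \<zero>\<^bsub>K\<^esub> = \<zero>\<^bsub>K\<^esub>" if "a \<in> carrier S" for a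
    using that
    by (intro additive_map_zero[OF K.M.abelian_group_axioms K.M.abelian_group_axioms])
       (auto intro: K.smult_r_distr)
  show ?thesis
  proof (intro left_module.intro left_module_axioms.intro)
    show "abelian_group ?M"
    proof (rule abelian_groupI)
      fix x assume x: "x \<in> carrier ?M"
      have "\<zero>\<^bsub>K\<^esub> = f (\<ominus>\<^bsub>N\<^esub> x \<oplus>\<^bsub>N\<^esub> x)"
        using x f0 by (simp add: N.M.l_neg)
      also have "\<dots> = f (\<ominus>\<^bsub>N\<^esub> x)"
        using x f(1)[of "\<ominus>\<^bsub>N\<^esub> x"] by (simp add: f(2))
      finally show "\<exists>y\<in>carrier ?M. y \<oplus>\<^bsub>?M\<^esub> x = \<zero>\<^bsub>?M\<^esub>"
        using x by (intro bexI[of _ "\<ominus>\<^bsub>N\<^esub> x"]) (auto simp: N.M.l_neg)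
    qed (auto simp: N.M.a_ac f f0)
  qed (auto simp: N.smult_l_distr N.smult_r_distr N.smult_assoc f a0 N.ring_axioms)
qed

text \<open>The \<open>RG\<close>-linear extension of an \<open>R\<close>-linear map to the induced module.\<close>

definition induced_ext :: "('g \<Rightarrow> 'r, 'n, 'c) module_scheme \<Rightarrow> ('v \<Rightarrow> 'n) \<Rightarrow> ('g \<Rightarrow> 'v) \<Rightarrow> 'n" where
  "induced_ext N \<psi> f = (\<Oplus>\<^bsub>N\<^esub>g\<in>carrier G. gr_monom R G g \<one> \<odot>\<^bsub>N\<^esub> \<psi> (f g))"

lemma induced_ext_hom:
  assumes "left_module RG N" "Module.module R V" "\<psi> \<in> mod_hom R V (restrict_scalars R G N)"
  shows "induced_ext N \<psi> \<in> mod_hom RG (induced_module G V) N"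
proof -
  interpret N: left_module RG N by fact
  interpret V: Module.module R V by fact
  have \<psi>: "\<psi> x \<in> carrier N" "\<psi> (x \<oplus>\<^bsub>V\<^esub> y) = \<psi> x \<oplus>\<^bsub>N\<^esub> \<psi> y"
      "\<psi> (r \<odot>\<^bsub>V\<^esub> x) = gr_monom R G \<one>\<^bsub>G\<^esub> r \<odot>\<^bsub>N\<^esub> \<psi> x"
    if "x \<in> carrier V" "y \<in> carrier V" "r \<in> carrier R" for x y r
    using mod_homD[OF assms(3)] that by auto
  have \<psi>_carrier: "\<psi> x \<in> carrier N" if "x \<in> carrier V" for x
    using \<psi>(1)[OF that that R.zero_closed] .
  show ?thesis
    unfolding mod_hom_def
  proof (intro CollectI conjI ballI funcsetI)
    fix f assume "f \<in> carrier (induced_module G V)"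
    then have f: "f g \<in> carrier V" if "g \<in> carrier G" for g
      using that by (auto simp: induced_module_def)
    then show "induced_ext N \<psi> f \<in> carrier N"
      by (auto simp: induced_ext_def \<psi>_carrier intro!: N.finsum_closed)
    fix f' assume "f' \<in> carrier (induced_module G V)"
    then have f': "f' g \<in> carrier V" if "g \<in> carrier G" for g
      using that by (auto simp: induced_module_def)
    show "induced_ext N \<psi> (f \<oplus>\<^bsub>induced_module G V\<^esub> f') = induced_ext N \<psi> f \<oplus>\<^bsub>N\<^esub> induced_ext N \<psi> f'"
      unfolding induced_ext_def
      by (subst N.finsum_addf[symmetric], (use f f' \<psi>_carrier in \<open>auto simp: Pi_def\<close>)[2],
          rule N.finsum_cong'[OF refl])
         (use f f' \<psi>(2)[OF _ _ R.zero_closed] in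
           \<open>simp_all add: Pi_def induced_module_def N.smult_r_distr \<psi>_carrier\<close>)
  next
    fix a f assume a: "a \<in> carrier RG" and "f \<in> carrier (induced_module G V)"
    then have f: "f g \<in> carrier V" if "g \<in> carrier G" for g
      using that by (auto simp: induced_module_def)
    have ac: "a h \<in> carrier R" if "h \<in> carrier G" for h
      using that gr_coeff[OF a] by simp
    let ?m = "\<lambda>h g. gr_monom R G (h \<otimes>\<^bsub>G\<^esub> g) (a h) \<odot>\<^bsub>N\<^esub> \<psi> (f g)"
    let ?n = "\<lambda>h g. gr_monom R G g (a h) \<odot>\<^bsub>N\<^esub> \<psi> (f (inv\<^bsub>G\<^esub> h \<otimes>\<^bsub>G\<^esub> g))"
    have \<psi>_sum: "\<psi> (\<Oplus>\<^bsub>V\<^esub>h\<in>carrier G. F h) = (\<Oplus>\<^bsub>N\<^esub>h\<in>carrier G. \<psi> (F h))" if "F \<in> carrier G \<rightarrow> carrier V" for F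
      using that finite_G \<psi>(2)[OF _ _ R.zero_closed]
      by (intro additive_map_finsum[OF V.M.abelian_group_axioms N.M.abelian_group_axioms]) (auto simp: \<psi>_carrier)
    have "induced_ext N \<psi> (a \<odot>\<^bsub>induced_module G V\<^esub> f)
        = (\<Oplus>\<^bsub>N\<^esub>g\<in>carrier G. \<Oplus>\<^bsub>N\<^esub>h\<in>carrier G. ?n h g)"
      unfolding induced_ext_def
    proof (rule N.finsum_cong'[OF refl])
      fix g assume g: "g \<in> carrier G"
      have "\<psi> ((a \<odot>\<^bsub>induced_module G V\<^esub> f) g)
          = \<psi> (\<Oplus>\<^bsub>V\<^esub>h\<in>carrier G. a h \<odot>\<^bsub>V\<^esub> f (inv\<^bsub>G\<^esub> h \<otimes>\<^bsub>G\<^esub> g))"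
        using g by (simp add: induced_module_def gr_conv_def)
      also have "\<dots> = (\<Oplus>\<^bsub>N\<^esub>h\<in>carrier G. \<psi> (a h \<odot>\<^bsub>V\<^esub> f (inv\<^bsub>G\<^esub> h \<otimes>\<^bsub>G\<^esub> g)))"
        by (rule \<psi>_sum) (use g ac f in auto)
      also have "\<dots> = (\<Oplus>\<^bsub>N\<^esub>h\<in>carrier G. gr_monom R G \<one>\<^bsub>G\<^esub> (a h) \<odot>\<^bsub>N\<^esub> \<psi> (f (inv\<^bsub>G\<^esub> h \<otimes>\<^bsub>G\<^esub> g)))"
        by (rule N.finsum_cong'[OF refl])
           (use g ac f \<psi>(3)[OF _ V.M.zero_closed] in \<open>simp_all add: Pi_def \<psi>_carrier\<close>)
      finally have "gr_monom R G g \<one> \<odot>\<^bsub>N\<^esub> \<psi> ((a \<odot>\<^bsub>induced_module G V\<^esub> f) g)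
          = (\<Oplus>\<^bsub>N\<^esub>h\<in>carrier G. gr_monom R G g \<one> \<odot>\<^bsub>N\<^esub> (gr_monom R G \<one>\<^bsub>G\<^esub> (a h) \<odot>\<^bsub>N\<^esub> \<psi> (f (inv\<^bsub>G\<^esub> h \<otimes>\<^bsub>G\<^esub> g))))"
        using g ac f finite_G by (simp add: N.smult_finsum Pi_def \<psi>_carrier)
      also have "\<dots> = (\<Oplus>\<^bsub>N\<^esub>h\<in>carrier G. ?n h g)"
        by (rule N.finsum_cong'[OF refl])
           (use g ac f in \<open>simp_all add: Pi_def \<psi>_carrier gr_monom_mult flip: N.smult_assoc\<close>)
      finally show "gr_monom R G g \<one> \<odot>\<^bsub>N\<^esub> \<psi> ((a \<odot>\<^bsub>induced_module G V\<^esub> f) g) = (\<Oplus>\<^bsub>N\<^esub>h\<in>carrier G. ?n h g)" .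
    qed (use ac f in \<open>simp add: Pi_def \<psi>_carrier N.finsum_closed\<close>)
    also have "\<dots> = (\<Oplus>\<^bsub>N\<^esub>h\<in>carrier G. \<Oplus>\<^bsub>N\<^esub>g\<in>carrier G. ?n h g)"
      using finite_G by (intro N.finsum_swap) (use ac f in \<open>simp_all add: \<psi>_carrier\<close>)
    also have "\<dots> = (\<Oplus>\<^bsub>N\<^esub>h\<in>carrier G. gr_monom R G h (a h) \<odot>\<^bsub>N\<^esub> induced_ext N \<psi> f)"
    proof (rule N.finsum_cong'[OF refl])
      fix h assume h: "h \<in> carrier G"
      have "(\<Oplus>\<^bsub>N\<^esub>g\<in>carrier G. ?n h g) = (\<Oplus>\<^bsub>N\<^esub>g\<in>carrier G. ?n h (h \<otimes>\<^bsub>G\<^esub> g))"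
        by (rule N.finsum_translate[OF G.group_axioms h]) (use h ac f in \<open>simp add: Pi_def \<psi>_carrier\<close>)
      also have "\<dots> = (\<Oplus>\<^bsub>N\<^esub>g\<in>carrier G. gr_monom R G h (a h) \<odot>\<^bsub>N\<^esub> (gr_monom R G g \<one> \<odot>\<^bsub>N\<^esub> \<psi> (f g)))"
        by (rule N.finsum_cong'[OF refl])
           (use h ac f in \<open>simp_all add: Pi_def \<psi>_carrier gr_monom_mult flip: N.smult_assoc\<close>)
      also have "\<dots> = gr_monom R G h (a h) \<odot>\<^bsub>N\<^esub> induced_ext N \<psi> f"
        unfolding induced_ext_def
        by (rule N.smult_finsum[symmetric]) (use h ac f finite_G in \<open>simp_all add: Pi_def \<psi>_carrier\<close>)
      finally show "(\<Oplus>\<^bsub>N\<^esub>g\<in>carrier G. ?n h g) = gr_monom R G h (a h) \<odot>\<^bsub>N\<^esub> induced_ext N \<psi> f" .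
    qed (use ac f in \<open>simp add: Pi_def induced_ext_def \<psi>_carrier N.finsum_closed\<close>)
    also have "\<dots> = (\<Oplus>\<^bsub>RG\<^esub>h\<in>carrier G. gr_monom R G h (a h)) \<odot>\<^bsub>N\<^esub> induced_ext N \<psi> f"
      by (rule N.finsum_smult[symmetric])
         (use ac f finite_G in \<open>simp_all add: Pi_def induced_ext_def \<psi>_carrier N.finsum_closed\<close>)
    also have "\<dots> = a \<odot>\<^bsub>N\<^esub> induced_ext N \<psi> f"
      using gr_sum_monom[OF a] by simp
    finally show "induced_ext N \<psi> (a \<odot>\<^bsub>induced_module G V\<^esub> f) = a \<odot>\<^bsub>N\<^esub> induced_ext N \<psi> f" .
  qed
qed

lemma relative_projective_imp_on:
  assumes "relative_projective R G C"
  shows "relative_projective_on TYPE('n) R G C"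
  unfolding relative_projective_on_def
proof (intro allI impI)
  fix M N :: "('g \<Rightarrow> 'r, 'n) module" and \<iota> :: "'n \<Rightarrow> 'n" and \<phi> :: "'n \<Rightarrow> 'g \<Rightarrow> 'r"
  let ?C = "module_of_code R G C"
  define V where "V = restrict_scalars R G ?C"
  define I where "I = induced_module G V"
  assume ex: "short_exact RG M \<iota> N \<phi> ?C"
  then interpret N: left_module RG N + C: left_module RG ?C
    by (simp_all add: short_exact_def)
  have \<phi>: "\<phi> \<in> mod_hom RG N ?C" using ex by (simp add: short_exact_def)
  assume "\<exists>\<psi>\<in>mod_hom R (restrict_scalars R G ?C) (restrict_scalars R G N). \<forall>c\<in>C. \<phi> (\<psi> c) = c"
  then obtain \<psi> where \<psi>: "\<psi> \<in> mod_hom R V (restrict_scalars R G N)" and sec: "\<And>c. c \<in> C \<Longrightarrow> \<phi> (\<psi> c) = c"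
    by (auto simp: V_def)
  have V: "Module.module R V"
    unfolding V_def by (rule module_restrict_scalars) (rule C.left_module_axioms)
  interpret V: Module.module R V by (rule V)
  interpret I: left_module RG I unfolding I_def by (rule left_module_induced[OF V])
  have car: "carrier ?C = C" "carrier V = C"
    by (simp_all add: module_of_code_def V_def)
  have I_mem: "f g \<in> C" if "f \<in> carrier I" "g \<in> carrier G" for f g
    using that by (auto simp: I_def induced_module_def car)
  have id: "(\<lambda>c. c) \<in> mod_hom R V (restrict_scalars R G ?C)"
    by (simp add: mod_hom_def V_def)
  define \<mu> where "\<mu> = induced_ext ?C (\<lambda>c. c)"
  have \<mu>: "\<mu> \<in> mod_hom RG I ?C"
    unfolding \<mu>_def I_def by (rule induced_ext_hom[OF C.left_module_axioms V id])
  define \<epsilon> where "\<epsilon> = (\<lambda>c. \<lambda>g\<in>carrier G. if g = \<one>\<^bsub>G\<^esub> then c else \<zero>\<^bsub>V\<^esub>)"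
  have \<epsilon>_carrier: "\<epsilon> c \<in> carrier I" if "c \<in> C" for c
    using that V.M.zero_closed by (auto simp: I_def induced_module_def car \<epsilon>_def)
  have \<mu>\<epsilon>: "\<mu> (\<epsilon> c) = c" if c: "c \<in> C" for c
  proof -
    have z: "gr_monom R G g \<one> \<odot>\<^bsub>?C\<^esub> \<zero>\<^bsub>?C\<^esub> = \<zero>\<^bsub>?C\<^esub>" if "g \<in> carrier G" for g
      using C.smult_r_distr[of "gr_monom R G g \<one>"]
      by (intro additive_map_zero[OF C.M.abelian_group_axioms C.M.abelian_group_axioms]) auto
    let ?F = "\<lambda>g. gr_monom R G g \<one> \<odot>\<^bsub>?C\<^esub> c"
    have c': "c \<in> carrier ?C" using c car by simp
    have "\<mu> (\<epsilon> c) = (\<Oplus>\<^bsub>?C\<^esub>g\<in>carrier G. if \<one>\<^bsub>G\<^esub> = g then ?F g else \<zero>\<^bsub>?C\<^esub>)"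
      unfolding \<mu>_def induced_ext_def
      by (rule C.finsum_cong'[OF refl]) (use c' z in \<open>auto simp: \<epsilon>_def V_def\<close>)
    also have "\<dots> = ?F \<one>\<^bsub>G\<^esub>"
      using finite_G c' by (intro C.finsum_singleton) auto
    also have "\<dots> = c" using c car by (simp flip: gr_one)
    finally show ?thesis .
  qed
  have \<epsilon>: "\<epsilon> \<in> mod_hom R V (restrict_scalars R G I)"
    unfolding mod_hom_def
  proof (intro CollectI conjI ballI funcsetI)
    fix r c assume rc: "r \<in> carrier R" "c \<in> carrier V"
    then have eI: "\<epsilon> c \<in> carrier G \<rightarrow>\<^sub>E carrier V"
      using \<epsilon>_carrier[of c] by (simp add: car I_def induced_module_def)
    have "gr_conv G V (gr_monom R G \<one>\<^bsub>G\<^esub> r) (\<epsilon> c) = \<epsilon> (r \<odot>\<^bsub>V\<^esub> c)"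
    proof (rule extensionalityI[of _ "carrier G"])
      fix g assume g: "g \<in> carrier G"
      show "gr_conv G V (gr_monom R G \<one>\<^bsub>G\<^esub> r) (\<epsilon> c) g = \<epsilon> (r \<odot>\<^bsub>V\<^esub> c) g"
        using conv_monom[OF V rc(1) G.one_closed eI g] g rc by (simp add: \<epsilon>_def)
    qed (simp_all add: \<epsilon>_def)
    then show "\<epsilon> (r \<odot>\<^bsub>V\<^esub> c) = r \<odot>\<^bsub>restrict_scalars R G I\<^esub> \<epsilon> c"
      by (simp add: I_def induced_module_def)
  next
    fix c d assume cd: "c \<in> carrier V" "d \<in> carrier V"
    then show "\<epsilon> (c \<oplus>\<^bsub>V\<^esub> d) = \<epsilon> c \<oplus>\<^bsub>restrict_scalars R G I\<^esub> \<epsilon> d"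
      by (auto simp: \<epsilon>_def I_def induced_module_def)
  qed (use \<epsilon>_carrier car in auto)
  define K where "K = I\<lparr>carrier := {x \<in> carrier I. \<mu> x = \<zero>\<^bsub>?C\<^esub>}\<rparr>"
  have exact: "short_exact RG K (\<lambda>x. x) I \<mu> ?C"
    unfolding short_exact_def
  proof (intro conjI)
    show "left_module RG K"
      unfolding K_def by (rule left_module_kernel[OF I.left_module_axioms C.left_module_axioms \<mu>])
    show "\<mu> ` carrier I = carrier ?C"
    proof
      show "carrier ?C \<subseteq> \<mu> ` carrier I"
        using \<mu>\<epsilon> \<epsilon>_carrier by (metis car(1) image_eqI subsetI)
    qed (use mod_homD(1)[OF \<mu>] in auto)
  qed (use \<mu> I.left_module_axioms C.left_module_axioms in \<open>auto simp: K_def mod_hom_def\<close>)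
  have split: "\<exists>\<psi>\<in>mod_hom R (restrict_scalars R G ?C) (restrict_scalars R G I). \<forall>c\<in>C. \<mu> (\<psi> c) = c"
    by (rule bexI[OF _ \<epsilon>[unfolded V_def]]) (simp add: \<mu>\<epsilon>)
  have "\<exists>\<psi>'\<in>mod_hom RG ?C I. \<forall>c\<in>C. \<mu> (\<psi>' c) = c"
    by (rule assms[unfolded relative_projective_def relative_projective_on_def,
          THEN spec, THEN spec, THEN spec, THEN spec, THEN mp, THEN mp, OF exact split])
  then obtain s where s: "s \<in> mod_hom RG ?C I" and s_sec: "\<And>c. c \<in> C \<Longrightarrow> \<mu> (s c) = c"
    by blast
  define \<theta> where "\<theta> = induced_ext N \<psi>"
  have \<theta>: "\<theta> \<in> mod_hom RG I N"
    unfolding \<theta>_def I_def by (rule induced_ext_hom[OF N.left_module_axioms V \<psi>])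
  have \<psi>_carrier: "\<psi> c \<in> carrier N" if "c \<in> C" for c
    using mod_homD(1)[OF \<psi>] that car by simp
  have \<phi>\<theta>: "\<phi> (\<theta> f) = \<mu> f" if f: "f \<in> carrier I" for f
  proof -
    have mem: "f g \<in> carrier ?C" if "g \<in> carrier G" for g
      using I_mem[OF f that] car by simp
    have "\<phi> (\<theta> f) = (\<Oplus>\<^bsub>?C\<^esub>g\<in>carrier G. \<phi> (gr_monom R G g \<one> \<odot>\<^bsub>N\<^esub> \<psi> (f g)))"
      unfolding \<theta>_def induced_ext_def
      by (rule additive_map_finsum[OF N.M.abelian_group_axioms C.M.abelian_group_axioms])
         (use mod_homD[OF \<phi>] \<psi>_carrier I_mem[OF f] finite_G in auto)
    also have "\<dots> = \<mu> f"
      unfolding \<mu>_def induced_ext_def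
      by (rule C.finsum_cong'[OF refl])
         (use mod_homD(3)[OF \<phi>] \<psi>_carrier I_mem[OF f] mem sec in \<open>simp_all add: Pi_def\<close>)
    finally show ?thesis .
  qed
  have "(\<lambda>c. \<theta> (s c)) \<in> mod_hom RG ?C N"
    using mod_homD[OF s] mod_homD[OF \<theta>] by (simp add: mod_hom_def)
  then show "\<exists>\<psi>'\<in>mod_hom RG ?C N. \<forall>c\<in>C. \<phi> (\<psi>' c) = c"
  proof (rule bexI[rotated], intro ballI)
    fix c assume c: "c \<in> C"
    then have "s c \<in> carrier I"
      using mod_homD(1)[OF s] car by simp
    with c show "\<phi> (\<theta> (s c)) = c"
      by (simp add: \<phi>\<theta> s_sec)
  qed
qed

end

theorem relative_projective_universal:
  fixes R :: "('r, 'a) ring_scheme" and G :: "('g, 'b) monoid_scheme"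
  assumes "cring R" "Group.group G" "finite (carrier G)" "relative_projective R G C"
  shows "relative_projective_on TYPE('n) R G C"
proof -
  interpret fin_group_ring R G
    using assms by (intro fin_group_ring.intro fin_group_ring_axioms.intro)
  show ?thesis using assms(4) by (rule relative_projective_imp_on)
qed

end

theory Submission
  imports Defs
begin

text \<open>
  The minimum distance of a left ideal is attained on its socle. A nonzero codeword \<open>c\<close> can be
  multiplied by the last power of \<open>\<pi>\<close> that does not kill it. The result is a nonzero codeword whose
  support lies in that of \<open>c\<close> and whose coefficients are annihilated by \<open>\<pi>\<close>, so they lie in
  \<open>m\<^sup>\<ell>\<^sup>-\<^sup>1\<close>. On \<open>m\<^sup>\<ell>\<^sup>-\<^sup>1 RG\<close> the isomorphism with \<open>FG\<close> preserves the Hamming weight.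
\<close>

section \<open>Arithmetic of a chain ring with a fixed generator of its maximal ideal\<close>

locale chain_ring_generator = artinian_chain_ring R + maximalideal m R for R (structure) and m +
  fixes \<pi>
  assumes generator_closed [simp]: "\<pi> \<in> carrier R"
    and generates: "m = PIdl \<pi>"
begin

abbreviation "len \<equiv> chain_length R m"

lemma mem_iff: "x \<in> m \<longleftrightarrow> (\<exists>s\<in>carrier R. x = s \<otimes> \<pi>)"
  by (subst generates) (auto simp: cgenideal_def)

text \<open>The ideals \<open>PIdl r\<close> and \<open>m\<close> are comparable, so
  \<open>PIdl r\<close> strictly contains \<open>m\<close>, and maximality makes it the whole
  ring.\<close>

lemma unit_if_notin:
  assumes "r \<in> carrier R" "r \<notin> m"
  shows "r \<in> Units R"
proof -
  have "\<not> PIdl r \<subseteq> m"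
    using assms cgenideal_self by blast
  then have "m \<subseteq> PIdl r"
    using ideals_chain[OF cgenideal_ideal[OF assms(1)] ideal_axioms] by blast
  then have "\<one> \<in> PIdl r"
    using I_maximal[OF cgenideal_ideal[OF assms(1)]] \<open>\<not> PIdl r \<subseteq> m\<close>
      additive_subgroup.a_subset[OF ideal.axioms(1)[OF cgenideal_ideal[OF assms(1)]]] by blast
  then obtain s where "s \<in> carrier R" "s \<otimes> r = \<one>"
    by (auto simp: cgenideal_def)
  then show ?thesis
    using assms(1) m_comm[of r s] by (auto simp: Units_def)
qed

lemma unit_mult_eq_zero:
  assumes "u \<in> Units R" "x \<in> carrier R" "u \<otimes> x = \<zero>"
  shows "x = \<zero>"
  using assms Units_l_cancel[of u x \<zero>] by (simp add: Units_closed)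

lemma pow_closed [simp]: "\<pi> [^] (n::nat) \<in> carrier R"
  by simp

text \<open>Products of a multiple of \<open>\<pi> [^] n\<close> and a multiple of
  \<open>\<pi>\<close> are multiples of \<open>\<pi> [^] Suc n\<close>, and sums stay there;
  conversely each such multiple is a single product of this kind. Questions about powers of
  \<open>m\<close> thus become questions about powers of \<open>\<pi>\<close>.\<close>

lemma ideal_power_eq: "ideal_power R m n = PIdl (\<pi> [^] n)"
proof (induction n)
  case 0
  have "PIdl \<one> = carrier R"
    by (auto simp: cgenideal_def) (metis r_one)
  then show ?case by (simp add: ideals_set_def nat_pow_def)
next
  case (Suc n)
  have "ideal_power R m (Suc n) = ideal_prod R (PIdl (\<pi> [^] n)) (PIdl \<pi>)"
    using Suc generates by (simp add: ideals_set_def nat_pow_def)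
  also have "\<dots> = PIdl (\<pi> [^] Suc n)"
  proof (intro equalityI subsetI)
    fix x assume "x \<in> ideal_prod R (PIdl (\<pi> [^] n)) (PIdl \<pi>)"
    then show "x \<in> PIdl (\<pi> [^] Suc n)"
    proof induction
      case (prod i j)
      then obtain a b where "a \<in> carrier R" "b \<in> carrier R" "i = a \<otimes> \<pi> [^] n" "j = b \<otimes> \<pi>"
        by (auto simp: cgenideal_def)
      then have "i \<otimes> j = (a \<otimes> b) \<otimes> \<pi> [^] Suc n" "a \<otimes> b \<in> carrier R"
        by (simp_all add: m_ac)
      then show ?case by (auto simp: cgenideal_def)
    next
      case (sum x y)
      then show ?case
        by (meson additive_subgroup.a_closed cgenideal_ideal ideal.axioms(1) pow_closed)
    qed
  next
    fix x assume "x \<in> PIdl (\<pi> [^] Suc n)"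
    then obtain a where a: "a \<in> carrier R" "x = (a \<otimes> \<pi> [^] n) \<otimes> (\<one> \<otimes> \<pi>)"
      by (auto simp: cgenideal_def m_assoc)
    show "x \<in> ideal_prod R (PIdl (\<pi> [^] n)) (PIdl \<pi>)"
      unfolding a(2) using a(1) cgenideal_self[OF generator_closed]
      by (intro ideal_prod.prod) (auto simp: cgenideal_def)
  qed
  finally show ?case .
qed

lemma PIdl_eq_zero_iff: "a \<in> carrier R \<Longrightarrow> PIdl a = {\<zero>} \<longleftrightarrow> a = \<zero>"
  using cgenideal_self[of a] unfolding cgenideal_def by fastforce

lemma pow_zero_mono: "\<pi> [^] n = \<zero> \<Longrightarrow> n \<le> k \<Longrightarrow> \<pi> [^] (k::nat) = \<zero>"
  using nat_pow_mult[OF generator_closed, of n "k - n"] by simp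

text \<open>The ideals generated by the powers of \<open>\<pi>\<close> stabilise, so
  \<open>\<pi> [^] n = r \<otimes> \<pi> [^] Suc n\<close> for some \<open>n\<close> and
  \<open>r\<close>. Hence \<open>\<one> \<ominus> r \<otimes> \<pi>\<close> annihilates
  \<open>\<pi> [^] n\<close>; lying outside \<open>m\<close>, it is a unit.\<close>

lemma generator_nilpotent: "\<exists>n::nat. \<pi> [^] n = \<zero>"
proof -
  have "\<exists>n::nat. \<forall>k\<ge>n. PIdl (\<pi> [^] k) = PIdl (\<pi> [^] n)"
  proof (rule descending_chain[of "\<lambda>n. PIdl (\<pi> [^] n)"])
    fix n :: nat
    show "ideal (PIdl (\<pi> [^] n)) R" by (rule cgenideal_ideal) simp
    show "PIdl (\<pi> [^] Suc n) \<subseteq> PIdl (\<pi> [^] n)"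
    proof
      fix x assume "x \<in> PIdl (\<pi> [^] Suc n)"
      then obtain r where r: "r \<in> carrier R" "x = r \<otimes> \<pi> [^] Suc n"
        by (auto simp: cgenideal_def)
      then have "x = (r \<otimes> \<pi>) \<otimes> \<pi> [^] n" by (simp add: m_ac)
      moreover have "r \<otimes> \<pi> \<in> carrier R" using r(1) by simp
      ultimately show "x \<in> PIdl (\<pi> [^] n)" unfolding cgenideal_def by blast
    qed
  qed
  then obtain n :: nat where "PIdl (\<pi> [^] Suc n) = PIdl (\<pi> [^] n)"
    by (meson le_SucI order_refl)
  then have "\<pi> [^] n \<in> PIdl (\<pi> [^] Suc n)"
    using cgenideal_self[of "\<pi> [^] n"] by simp
  then obtain r where r: "r \<in> carrier R" "\<pi> [^] n = r \<otimes> \<pi> [^] Suc n"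
    by (auto simp: cgenideal_def)
  define u where "u = \<one> \<ominus> r \<otimes> \<pi>"
  have u: "u \<in> carrier R" using r by (simp add: u_def)
  have rm: "r \<otimes> \<pi> \<in> m"
    using r(1) mem_iff by blast
  have "u \<notin> m"
  proof
    assume "u \<in> m"
    then have "u \<oplus> r \<otimes> \<pi> \<in> m" using rm by (rule a_closed)
    also have "u \<oplus> r \<otimes> \<pi> = \<one>"
      using r(1) by (simp add: u_def minus_eq a_assoc l_neg)
    finally show False
      using one_imp_carrier I_notcarr by blast
  qed
  then have "u \<in> Units R" by (rule unit_if_notin[OF u])
  moreover have "u \<otimes> \<pi> [^] n = \<pi> [^] n \<ominus> r \<otimes> \<pi> [^] Suc n"
    using r(1) by (simp add: u_def minus_eq l_distr l_minus m_assoc m_comm[of \<pi>])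
  then have "u \<otimes> \<pi> [^] n = \<zero>" using r(2) by (metis pow_closed r_right_minus_eq)
  ultimately have "\<pi> [^] n = \<zero>"
    using unit_mult_eq_zero[OF _ pow_closed] by blast
  then show ?thesis ..
qed

text \<open>Through \<open>ideal_power_eq\<close>, the length of the ring is the nilpotency index of
  \<open>\<pi>\<close>.\<close>

lemma pow_eq_zero_iff: "\<pi> [^] n = \<zero> \<longleftrightarrow> len \<le> n"
proof -
  have *: "len = (LEAST n. \<pi> [^] n = \<zero>)"
    by (simp add: chain_length_def ideal_power_eq PIdl_eq_zero_iff)
  have "\<pi> [^] len = \<zero>"
    unfolding * using generator_nilpotent by (rule LeastI_ex)
  moreover have "len \<le> n" if "\<pi> [^] n = \<zero>"
    unfolding * using that by (rule Least_le)
  ultimately show ?thesis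
    using pow_zero_mono by blast
qed

text \<open>Ensures that \<open>len - Suc 0\<close> is a true predecessor, so that the power of
  \<open>\<pi>\<close> with this exponent is nonzero.\<close>

lemma len_pos: "0 < len"
proof (rule ccontr)
  assume "\<not> 0 < len"
  then have "\<one> = \<zero>" using pow_eq_zero_iff[of 0] by simp
  then have "\<one> \<in> m" by simp
  then show False using one_imp_carrier I_notcarr by blast
qed

text \<open>A nonzero \<open>x\<close> equals \<open>\<pi> [^] i\<close> times a unit, where
  \<open>i\<close> is the largest exponent with \<open>\<pi> [^] i\<close> dividing
  \<open>x\<close>. Then \<open>\<pi> \<otimes> x = \<zero>\<close> forces
  \<open>\<pi> [^] Suc i = \<zero>\<close>, which leaves only
  \<open>i = len - Suc 0\<close>.\<close>

lemma annihilator_generator: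
  assumes "x \<in> carrier R" "\<pi> \<otimes> x = \<zero>"
  obtains r where "r \<in> carrier R" "x = \<pi> [^] (len - Suc 0) \<otimes> r"
proof (cases "x = \<zero>")
  case True
  then show ?thesis by (intro that[of \<zero>]) simp_all
next
  case False
  let ?P = "\<lambda>i. \<exists>r\<in>carrier R. x = \<pi> [^] (i::nat) \<otimes> r"
  have 0: "?P 0" using assms(1) by (intro bexI[of _ x]) simp_all
  \<comment> \<open>An exponent beyond \<open>len\<close> would give \<open>x = \<zero>\<close>, so
    a largest one exists.\<close>
  have bound: "i \<le> len" if "?P i" for i
    using that False pow_eq_zero_iff[of i] by (cases "i \<le> len") auto
  obtain i where i: "?P i" "\<And>k. ?P k \<Longrightarrow> k \<le> i"
    using Nat.ex_has_greatest_nat[of ?P, OF 0] bound by blast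
  then obtain r where r: "r \<in> carrier R" "x = \<pi> [^] i \<otimes> r" by blast
  have "r \<notin> m"
  proof
    assume "r \<in> m"
    then obtain s where s: "s \<in> carrier R" "r = s \<otimes> \<pi>"
      using mem_iff by blast
    then have "x = \<pi> [^] Suc i \<otimes> s" using r by (simp add: m_ac)
    with s(1) have "?P (Suc i)" by blast
    then show False using i(2)[of "Suc i"] by simp
  qed
  then have "r \<in> Units R" by (rule unit_if_notin[OF r(1)])
  moreover have "r \<otimes> \<pi> [^] Suc i = \<zero>" using assms(2) r by (simp add: m_ac)
  ultimately have "\<pi> [^] Suc i = \<zero>"
    using unit_mult_eq_zero[OF _ pow_closed] by blast
  then have "len \<le> Suc i" by (simp only: pow_eq_zero_iff)
  moreover have "\<pi> [^] i \<noteq> \<zero>" using False r by auto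
  then have "i < len" by (simp add: pow_eq_zero_iff)
  ultimately have "i = len - Suc 0" by simp
  with r that show ?thesis by blast
qed

text \<open>An \<open>r\<close> outside \<open>m\<close> is a unit and cannot annihilate the last
  nonzero power of \<open>\<pi>\<close>; an \<open>r\<close> inside \<open>m\<close> supplies the
  one missing factor \<open>\<pi>\<close>.\<close>

lemma socle_mult_eq_zero_iff:
  assumes "r \<in> carrier R"
  shows "\<pi> [^] (len - Suc 0) \<otimes> r = \<zero> \<longleftrightarrow> r \<in> m"
proof
  assume eq: "\<pi> [^] (len - Suc 0) \<otimes> r = \<zero>"
  show "r \<in> m"
  proof (rule ccontr)
    assume "r \<notin> m"
    then have "r \<in> Units R" by (rule unit_if_notin[OF assms])
    moreover have "r \<otimes> \<pi> [^] (len - Suc 0) = \<zero>" using eq assms by (simp add: m_comm)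
    ultimately have "\<pi> [^] (len - Suc 0) = \<zero>"
      using unit_mult_eq_zero[OF _ pow_closed] by blast
    then show False using len_pos by (simp add: pow_eq_zero_iff)
  qed
next
  assume "r \<in> m"
  then obtain s where s: "s \<in> carrier R" "r = s \<otimes> \<pi>"
    using mem_iff by blast
  then have "\<pi> [^] (len - Suc 0) \<otimes> r = \<pi> [^] Suc (len - Suc 0) \<otimes> s" by (simp add: m_ac)
  moreover have "\<pi> [^] Suc (len - Suc 0) = \<zero>" unfolding pow_eq_zero_iff by simp
  ultimately show "\<pi> [^] (len - Suc 0) \<otimes> r = \<zero>" using s by simp
qed

text \<open>Multiplication by the last nonzero power of \<open>\<pi>\<close> has kernel
  \<open>m\<close>. This makes the coefficient map of the top layer well defined and
  injective.\<close>

lemma socle_mult_eq_iff: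
  assumes "r \<in> carrier R" "s \<in> carrier R"
  shows "\<pi> [^] (len - Suc 0) \<otimes> r = \<pi> [^] (len - Suc 0) \<otimes> s \<longleftrightarrow> m +> r = m +> s"
proof -
  have "\<pi> [^] (len - Suc 0) \<otimes> r = \<pi> [^] (len - Suc 0) \<otimes> s
      \<longleftrightarrow> \<pi> [^] (len - Suc 0) \<otimes> r \<ominus> \<pi> [^] (len - Suc 0) \<otimes> s = \<zero>"
    using assms by simp
  also have "\<dots> \<longleftrightarrow> \<pi> [^] (len - Suc 0) \<otimes> (r \<ominus> s) = \<zero>"
    using assms by (simp add: minus_eq r_distr r_minus)
  also have "\<dots> \<longleftrightarrow> r \<ominus> s \<in> m" using assms by (simp add: socle_mult_eq_zero_iff)
  also have "\<dots> \<longleftrightarrow> m +> r = m +> s"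
    using assms by (simp add: quotient_eq_iff_same_a_r_cos[OF ideal_axioms])
  finally show ?thesis .
qed

lemma coset_eq_iff: "r \<in> carrier R \<Longrightarrow> m +> r = m \<longleftrightarrow> r \<in> m"
  using a_rcos_const[of r] a_rcos_self[of r] by blast

end

section \<open>Scalars, zero words and principal ideals in the group ring\<close>

lemma (in fin_group_ring) gr_scalar_mult:
  assumes "r \<in> carrier R" "x \<in> carrier RG" "g \<in> carrier G"
  shows "(gr_scalar R G r \<otimes>\<^bsub>RG\<^esub> x) g = r \<otimes> x g"
  using conv_monom[OF regular_module, of r "\<one>\<^bsub>G\<^esub>" x g] assms
  by (simp add: gr_mult_eq_conv) (simp add: regular_module_def gr_carrier[symmetric])

text \<open>Phrased for extensional functions so that it serves for words over \<open>R\<close> and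
  over \<open>R Quot m\<close> alike.\<close>

lemma group_ring_eq_zero_iff:
  assumes "x \<in> extensional (carrier G)"
  shows "x = \<zero>\<^bsub>group_ring R G\<^esub> \<longleftrightarrow> (\<forall>g\<in>carrier G. x g = \<zero>\<^bsub>R\<^esub>)"
  using assms by (auto simp: group_ring_def intro!: extensionalityI[of _ "carrier G"])

lemma (in fin_group_ring) gr_eq_zero_iff:
  "x \<in> carrier RG \<Longrightarrow> x = \<zero>\<^bsub>RG\<^esub> \<longleftrightarrow> (\<forall>g\<in>carrier G. x g = \<zero>)"
  by (rule group_ring_eq_zero_iff) (simp add: gr_carrier PiE_iff)

text \<open>The coefficientwise condition survives products with group ring elements and sums.
  Conversely, \<open>a\<close> can be divided out of all coefficients at once, which exhibits the
  word as one scalar multiple.\<close>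

lemma (in fin_group_ring) ideal_gr_principal:
  assumes a: "a \<in> carrier R"
  shows "ideal_gr R G (PIdl a) = {x \<in> carrier RG. \<forall>g\<in>carrier G. x g \<in> PIdl a}"
proof (intro equalityI subsetI)
  interpret RG: ring RG by (rule ring_group_ring)
  interpret I: ideal "PIdl a" R by (rule cgenideal_ideal[OF a])
  fix x assume "x \<in> ideal_gr R G (PIdl a)"
  then have "x \<in> ideal_prod RG (gr_scalar R G ` (PIdl a)) (carrier RG)"
    by (simp add: ideal_gr_def)
  then show "x \<in> {x \<in> carrier RG. \<forall>g\<in>carrier G. x g \<in> PIdl a}"
  proof induction
    case (prod i j)
    then show ?case
      by (auto simp: gr_scalar_mult I.Icarr gr_coeff intro!: I.I_r_closed)
  next
    case (sum x y)
    then show ?case by (auto simp: gr_add_closed) (simp add: group_ring_def)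
  qed
next
  fix x assume x: "x \<in> {x \<in> carrier RG. \<forall>g\<in>carrier G. x g \<in> PIdl a}"
  then have "\<forall>g\<in>carrier G. \<exists>r\<in>carrier R. x g = a \<otimes> r"
    using a R.m_comm by (fastforce simp: cgenideal_def)
  then obtain y where y: "\<And>g. g \<in> carrier G \<Longrightarrow> y g \<in> carrier R \<and> x g = a \<otimes> y g"
    by metis
  \<comment> \<open>The chosen cofactors form the quotient word; restricting them makes it
    extensional, as membership in \<open>RG\<close> demands.\<close>
  define z where "z = restrict y (carrier G)"
  have z: "z \<in> carrier RG" using y by (auto simp: z_def gr_carrier)
  interpret RG: ring RG by (rule ring_group_ring)
  have "x = gr_scalar R G a \<otimes>\<^bsub>RG\<^esub> z"
  proof (rule extensionalityI[of _ "carrier G"])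
    show "x \<in> extensional (carrier G)" using x by (simp add: gr_carrier PiE_iff)
    have "gr_scalar R G a \<otimes>\<^bsub>RG\<^esub> z \<in> carrier RG" using a z by simp
    then show "gr_scalar R G a \<otimes>\<^bsub>RG\<^esub> z \<in> extensional (carrier G)"
      by (simp add: gr_carrier PiE_iff)
    show "x g = (gr_scalar R G a \<otimes>\<^bsub>RG\<^esub> z) g" if "g \<in> carrier G" for g
      using that y a z by (simp add: gr_scalar_mult) (simp add: z_def)
  qed
  then show "x \<in> ideal_gr R G (PIdl a)"
    using z a cgenideal_self by (auto simp: ideal_gr_def intro!: ideal_prod.prod)
qed

section \<open>The top layer of the chain and its weight-preserving map\<close>

locale chain_group_ring = chain_ring_generator R m \<pi> + fin_group_ring R G
  for R :: "('r, 'a) ring_scheme" (structure) and m \<pi> and G :: "('g, 'b) monoid_scheme" (structure)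
begin

text \<open>The socle of \<open>RG\<close> as an \<open>R\<close>-module: by
  \<open>annihilator_generator\<close> it contains every word killed by
  \<open>\<pi>\<close>.\<close>

abbreviation "socle_gr \<equiv> ideal_gr R G (ideal_power R m (len - Suc 0))"

lemma socle_gr_mem_iff:
  "x \<in> socle_gr \<longleftrightarrow> x \<in> carrier RG \<and> (\<forall>g\<in>carrier G. \<exists>r\<in>carrier R. x g = \<pi> [^] (len - Suc 0) \<otimes> r)"
proof -
  have "y \<in> PIdl (\<pi> [^] (len - Suc 0)) \<longleftrightarrow> (\<exists>r\<in>carrier R. y = \<pi> [^] (len - Suc 0) \<otimes> r)" for y
    using m_comm[OF pow_closed] by (auto simp: cgenideal_def)
  then show ?thesis by (simp add: ideal_power_eq ideal_gr_principal)
qed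

text \<open>The submodule is zero because the exponent reaches \<open>len\<close>. Cosets in the top
  layer are therefore single words, and \<open>chain_iso\<close> can be evaluated on
  \<open>{x}\<close>.\<close>

lemma coset_top:
  assumes "x \<in> carrier RG"
  shows "ideal_gr R G (ideal_power R m (Suc (len - Suc 0))) +>\<^bsub>RG\<^esub> x = {x}"
proof -
  interpret RG: ring RG by (rule ring_group_ring)
  have 0: "\<pi> [^] Suc (len - Suc 0) = \<zero>" unfolding pow_eq_zero_iff by simp
  then have P: "PIdl (\<pi> [^] Suc (len - Suc 0)) = {\<zero>}"
    using PIdl_eq_zero_iff[OF pow_closed] by blast
  have "ideal_gr R G (ideal_power R m (Suc (len - Suc 0)))
      = {x \<in> carrier RG. \<forall>g\<in>carrier G. x g \<in> PIdl (\<pi> [^] Suc (len - Suc 0))}"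
    unfolding ideal_power_eq by (rule ideal_gr_principal) (rule pow_closed)
  also have "\<dots> = {\<zero>\<^bsub>RG\<^esub>}"
    unfolding P using gr_eq_zero_iff RG.zero_closed by blast
  finally show ?thesis
    using assms by (simp add: a_r_coset_def r_coset_def)
qed

text \<open>The definite description is justified by \<open>socle_mult_eq_iff\<close>: all
  admissible cofactors of \<open>x g\<close> lie in one coset of \<open>m\<close>.\<close>

lemma chain_iso_apply:
  assumes "g \<in> carrier G" "r \<in> carrier R" "x g = \<pi> [^] (len - Suc 0) \<otimes> r"
  shows "chain_iso R G \<pi> m (len - Suc 0) {x} g = m +> r"
proof -
  have "(THE c. \<exists>s\<in>carrier R. x g = \<pi> [^] (len - Suc 0) \<otimes> s \<and> c = m +> s) = m +> r"
    by (rule the_equality) (use assms socle_mult_eq_iff in auto)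
  then show ?thesis using assms(1) by (simp add: chain_iso_def)
qed

lemma chain_iso_eq_zero_iff:
  assumes "x \<in> socle_gr" "g \<in> carrier G"
  shows "chain_iso R G \<pi> m (len - Suc 0) {x} g = \<zero>\<^bsub>R Quot m\<^esub> \<longleftrightarrow> x g = \<zero>"
proof -
  obtain r where r: "r \<in> carrier R" "x g = \<pi> [^] (len - Suc 0) \<otimes> r"
    using assms socle_gr_mem_iff by blast
  then show ?thesis
    using chain_iso_apply[of g r x] assms(2)
    by (simp add: FactRing_def coset_eq_iff socle_mult_eq_zero_iff)
qed

lemma hamming_weight_chain_iso:
  assumes "x \<in> socle_gr"
  shows "hamming_weight (R Quot m) G (chain_iso R G \<pi> m (len - Suc 0) {x}) = hamming_weight R G x"
  unfolding hamming_weight_def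
  by (rule arg_cong[where f = card]) (use chain_iso_eq_zero_iff[OF assms] in blast)

lemma chain_iso_eq_zero:
  assumes "x \<in> socle_gr"
  shows "chain_iso R G \<pi> m (len - Suc 0) {x} = \<zero>\<^bsub>group_ring (R Quot m) G\<^esub> \<longleftrightarrow> x = \<zero>\<^bsub>RG\<^esub>"
proof -
  have "x \<in> extensional (carrier G)"
    using assms by (simp add: socle_gr_mem_iff gr_carrier PiE_iff)
  moreover have "chain_iso R G \<pi> m (len - Suc 0) {x} \<in> extensional (carrier G)"
    by (simp add: chain_iso_def)
  ultimately show ?thesis
    using chain_iso_eq_zero_iff[OF assms] by (simp add: group_ring_eq_zero_iff)
qed

lemma chain_code_top:
  "chain_code R G \<pi> m C (len - Suc 0) = (\<lambda>x. chain_iso R G \<pi> m (len - Suc 0) {x}) ` (C \<inter> socle_gr)"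
  unfolding chain_code_def image_image
  by (rule image_cong[OF refl], subst coset_top) (simp_all add: socle_gr_mem_iff)

text \<open>Nonzero socle words of \<open>C\<close> map onto the nonzero words of the top code with
  equal weights, so both infima run over the same values.\<close>

lemma min_distance_chain_code_top:
  "min_distance (R Quot m) G (chain_code R G \<pi> m C (len - Suc 0)) = min_distance R G (C \<inter> socle_gr)"
proof -
  have "chain_code R G \<pi> m C (len - Suc 0) - {\<zero>\<^bsub>group_ring (R Quot m) G\<^esub>}
      = (\<lambda>x. chain_iso R G \<pi> m (len - Suc 0) {x}) ` (C \<inter> socle_gr - {\<zero>\<^bsub>RG\<^esub>})"
    unfolding chain_code_top by (auto simp: chain_iso_eq_zero)
  then have "min_distance (R Quot m) G (chain_code R G \<pi> m C (len - Suc 0))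
      = (INF x\<in>C \<inter> socle_gr - {\<zero>\<^bsub>RG\<^esub>}.
          enat (hamming_weight (R Quot m) G (chain_iso R G \<pi> m (len - Suc 0) {x})))"
    unfolding min_distance_def by (simp only: image_image)
  also have "\<dots> = min_distance R G (C \<inter> socle_gr)"
    unfolding min_distance_def by (rule INF_cong[OF refl]) (simp add: hamming_weight_chain_iso)
  finally show ?thesis .
qed

section \<open>Descent of codewords to the socle and comparison of the distances\<close>

lemma socle_word_below:
  assumes "group_code R G C" "c \<in> C" "c \<noteq> \<zero>\<^bsub>RG\<^esub>"
  obtains d where "d \<in> C \<inter> socle_gr" "d \<noteq> \<zero>\<^bsub>RG\<^esub>" "hamming_weight R G d \<le> hamming_weight R G c"
proof -
  interpret C: left_ideal C RG using assms(1) by (simp add: group_code_def)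
  have c: "c \<in> carrier RG" using assms(2) C.a_subset by blast
  define D where "D k = gr_scalar R G (\<pi> [^] (k::nat)) \<otimes>\<^bsub>RG\<^esub> c" for k
  have DC: "D k \<in> C" for k
    unfolding D_def using assms(2) by (intro C.l_closed) simp_all
  then have D_carrier: "D k \<in> carrier RG" for k using C.a_subset by blast
  have D_apply: "D k g = \<pi> [^] k \<otimes> c g" if "g \<in> carrier G" for k g
    using that c by (simp add: D_def gr_scalar_mult)
  note D_zero_iff = gr_eq_zero_iff[OF D_carrier]
  have "\<one>\<^bsub>RG\<^esub> \<otimes>\<^bsub>RG\<^esub> c = c" using c by simp
  then have "D 0 \<noteq> \<zero>\<^bsub>RG\<^esub>" using assms(3) by (simp add: D_def gr_one)
  moreover have "\<pi> [^] len = \<zero>" by (simp add: pow_eq_zero_iff)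
  then have "D len = \<zero>\<^bsub>RG\<^esub>" using c by (simp add: D_zero_iff D_apply gr_coeff)
  \<comment> \<open>Induction read backwards: being nonzero holds at \<open>0\<close> and fails at
    \<open>len\<close>, so some successor step destroys it.\<close>
  ultimately have "\<exists>k. D k \<noteq> \<zero>\<^bsub>RG\<^esub> \<and> D (Suc k) = \<zero>\<^bsub>RG\<^esub>"
    using nat_induct[of "\<lambda>k. D k \<noteq> \<zero>\<^bsub>RG\<^esub>" len] by metis
  then obtain k where k: "D k \<noteq> \<zero>\<^bsub>RG\<^esub>" "D (Suc k) = \<zero>\<^bsub>RG\<^esub>"
    by blast
  have "\<exists>r\<in>carrier R. D k g = \<pi> [^] (len - Suc 0) \<otimes> r" if g: "g \<in> carrier G" for g
  proof -
    have cg: "c g \<in> carrier R" by (rule gr_coeff[OF c g])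
    \<comment> \<open>The next multiple vanishes, so \<open>\<pi>\<close> annihilates every
      coefficient of \<open>D k\<close>.\<close>
    have "\<pi> \<otimes> D k g = D (Suc k) g" using g cg by (simp add: D_apply m_ac)
    also have "\<dots> = \<zero>" using k(2) g D_zero_iff[of "Suc k"] by simp
    finally obtain r where "r \<in> carrier R" "D k g = \<pi> [^] (len - Suc 0) \<otimes> r"
      by (rule annihilator_generator[OF gr_coeff[OF D_carrier g]])
    then show ?thesis ..
  qed
  then have "D k \<in> C \<inter> socle_gr" using DC D_carrier by (simp add: socle_gr_mem_iff)
  moreover have "hamming_weight R G (D k) \<le> hamming_weight R G c"
    unfolding hamming_weight_def
    \<comment> \<open>Scaling keeps zero coefficients zero, so the support can only shrink.\<close>
    by (rule card_mono) (use finite_G in \<open>auto simp: D_apply\<close>)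
  ultimately show ?thesis using k(1) that by blast
qed

text \<open>Each index set dominates the other: \<open>socle_word_below\<close> gives a lighter or
  equally light socle word, and inclusion gives the converse. For the zero code both sets are empty
  and both sides are \<open>\<infinity>\<close>.\<close>

lemma min_distance_socle:
  assumes "group_code R G C"
  shows "min_distance R G C = min_distance R G (C \<inter> socle_gr)"
  unfolding min_distance_def
proof (rule INF_eq)
  fix c assume "c \<in> C - {\<zero>\<^bsub>RG\<^esub>}"
  then obtain d where "d \<in> C \<inter> socle_gr" "d \<noteq> \<zero>\<^bsub>RG\<^esub>" "hamming_weight R G d \<le> hamming_weight R G c"
    using socle_word_below[OF assms] by blast
  then show "\<exists>d\<in>C \<inter> socle_gr - {\<zero>\<^bsub>RG\<^esub>}. enat (hamming_weight R G d) \<le> enat (hamming_weight R G c)"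
    by (intro bexI[of _ d]) auto
next
  fix d assume "d \<in> C \<inter> socle_gr - {\<zero>\<^bsub>RG\<^esub>}"
  then show "\<exists>c\<in>C - {\<zero>\<^bsub>RG\<^esub>}. enat (hamming_weight R G c) \<le> enat (hamming_weight R G d)"
    by (intro bexI[of _ d]) auto
qed

end

theorem theorem2p11:
  fixes R :: "('r, 'a) ring_scheme" and G :: "('g, 'b) monoid_scheme"
    and \<pi> :: 'r and m :: "'r set" and p :: nat and C :: "('g \<Rightarrow> 'r) set"
  assumes "artinian_chain_ring R"
    and "maximalideal m R"
    and "\<pi> \<in> carrier R" and "m = PIdl\<^bsub>R\<^esub> \<pi>"
    and "finite (carrier (R Quot m))"
    and "p = group.ord (add_monoid (R Quot m)) \<one>\<^bsub>R Quot m\<^esub>"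
    and "group G" and "finite (carrier G)"
    and "group_code R G C"
    and "relative_projective R G C"
  shows "min_distance R G C
    = min_distance (R Quot m) G (chain_code R G \<pi> m C (chain_length R m - 1))"
proof -
  interpret artinian_chain_ring R by fact
  interpret chain_group_ring R m \<pi> G
    using assms
    by (intro chain_group_ring.intro chain_ring_generator.intro chain_ring_generator_axioms.intro
        fin_group_ring.intro fin_group_ring_axioms.intro is_cring)
  show ?thesis
    \<comment> \<open>The index \<open>chain_length R m - 1\<close> simplifies to the form
      \<open>len - Suc 0\<close> used above.\<close>
    using min_distance_socle[OF assms(9)] min_distance_chain_code_top by simp
qed

end
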